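(* Let $R$ be a Noetherian (commutative) ring, $S$ a multiplicative subset of $R$, and $I$ a $0$-dimensional ideal of $R$. Then $$\mathrm{core}(S^{-1}I)=S^{-1}\mathrm{core}(I).$$
   Context: An ideal $I$ is $0$-dimensional if $\dim R/I=0$. A subideal $J$ of an ideal $I$ is a reduction of $I$ if $I^{r+1}=JI^r$ for some integer $r\ge 0$. $\mathrm{core}(I)$ is the intersection of all reductions of $I$; $\mathrm{core}(S^{-1}I)$ is the core of $S^{-1}I$ as an ideal of $S^{-1}R$. *)

theory Defs
  imports "HOL-Algebra.Ring_Divisibility" "HOL-Algebra.Ideal_Product" "HOL-Algebra.QuotRing" "HOL-Library.Extended_Real"
begin

section \<open>Localization of a commutative ring\<close>

text \<open>
  Zero divisors in \<open>S\<close>, and even \<open>\<zero> \<in> S\<close>, are allowed, so the cross-multiplied equation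
  only has to hold up to a factor from \<open>S\<close>.
\<close>

definition loc_rel :: "('a, 'b) ring_scheme \<Rightarrow> 'a set \<Rightarrow> (('a \<times> 'a) \<times> ('a \<times> 'a)) set"
  where "loc_rel R S =
    {((a, s), (b, t)). a \<in> carrier R \<and> b \<in> carrier R \<and> s \<in> S \<and> t \<in> S \<and>
       (\<exists>u\<in>S. u \<otimes>\<^bsub>R\<^esub> (a \<otimes>\<^bsub>R\<^esub> t) = u \<otimes>\<^bsub>R\<^esub> (b \<otimes>\<^bsub>R\<^esub> s))}"

definition loc_frac :: "('a, 'b) ring_scheme \<Rightarrow> 'a set \<Rightarrow> 'a \<Rightarrow> 'a \<Rightarrow> ('a \<times> 'a) set"
  where "loc_frac R S a s = loc_rel R S `` {(a, s)}"

text \<open>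
  The operations are given on equivalence classes by uniting over all representatives;
  \<open>loc_add_frac\<close> and \<open>loc_mult_frac\<close> below give the usual formulas for fractions.
\<close>

definition localization :: "('a, 'b) ring_scheme \<Rightarrow> 'a set \<Rightarrow> ('a \<times> 'a) set ring"
  where "localization R S =
    \<lparr>carrier = (carrier R \<times> S) // loc_rel R S,
     mult = (\<lambda>A B. \<Union>x\<in>A. \<Union>y\<in>B.
               case (x, y) of ((a, s), (b, t)) \<Rightarrow>
                 loc_frac R S (a \<otimes>\<^bsub>R\<^esub> b) (s \<otimes>\<^bsub>R\<^esub> t)),
     one = loc_frac R S \<one>\<^bsub>R\<^esub> \<one>\<^bsub>R\<^esub>,
     zero = loc_frac R S \<zero>\<^bsub>R\<^esub> \<one>\<^bsub>R\<^esub>,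
     add = (\<lambda>A B. \<Union>x\<in>A. \<Union>y\<in>B.
              case (x, y) of ((a, s), (b, t)) \<Rightarrow>
                loc_frac R S (a \<otimes>\<^bsub>R\<^esub> t \<oplus>\<^bsub>R\<^esub> b \<otimes>\<^bsub>R\<^esub> s) (s \<otimes>\<^bsub>R\<^esub> t))\<rparr>"

definition loc_ideal :: "('a, 'b) ring_scheme \<Rightarrow> 'a set \<Rightarrow> 'a set \<Rightarrow> ('a \<times> 'a) set set"
  where "loc_ideal R S I = {loc_frac R S a s | a s. a \<in> I \<and> s \<in> S}"

locale ring_with_mult_set = cring R + submonoid S R
  for R :: "('a, 'b) ring_scheme" (structure) and S
begin

lemma S_carr [simp]: "s \<in> S \<Longrightarrow> s \<in> carrier R"
  using subset by blast

lemma equiv_loc_rel: "equiv (carrier R \<times> S) (loc_rel R S)"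
proof (rule equivI)
  show "loc_rel R S \<subseteq> (carrier R \<times> S) \<times> (carrier R \<times> S)"
    by (auto simp: loc_rel_def)
  show "refl_on (carrier R \<times> S) (loc_rel R S)"
    by (auto simp: loc_rel_def refl_on_def intro!: bexI[of _ "\<one>"])
  show "sym (loc_rel R S)"
    by (auto simp: loc_rel_def sym_def) metis
  show "trans (loc_rel R S)"
  proof (rule transI, clarify)
    fix a s b t c v
    assume "((a, s), (b, t)) \<in> loc_rel R S" "((b, t), (c, v)) \<in> loc_rel R S"
    then obtain u w where c [simp]: "a \<in> carrier R" "b \<in> carrier R" "c \<in> carrier R"
        "s \<in> S" "t \<in> S" "v \<in> S" "u \<in> S" "w \<in> S"
      and u: "u \<otimes> (a \<otimes> t) = u \<otimes> (b \<otimes> s)" and w: "w \<otimes> (b \<otimes> v) = w \<otimes> (c \<otimes> t)"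
      by (auto simp: loc_rel_def)
    have "(u \<otimes> w \<otimes> t) \<otimes> (a \<otimes> v) = (w \<otimes> v) \<otimes> (u \<otimes> (a \<otimes> t))"
      by (simp add: m_ac)
    also have "\<dots> = (u \<otimes> s) \<otimes> (w \<otimes> (b \<otimes> v))"
      unfolding u by (simp add: m_ac)
    also have "\<dots> = (u \<otimes> w \<otimes> t) \<otimes> (c \<otimes> s)"
      unfolding w by (simp add: m_ac)
    finally show "((a, s), (c, v)) \<in> loc_rel R S"
      by (auto simp: loc_rel_def intro!: bexI[of _ "u \<otimes> w \<otimes> t"])
  qed
qed

lemma loc_frac_eq_iff:
  assumes "a \<in> carrier R" "b \<in> carrier R" "s \<in> S" "t \<in> S"
  shows "loc_frac R S a s = loc_frac R S b t \<longleftrightarrow> (\<exists>u\<in>S. u \<otimes> (a \<otimes> t) = u \<otimes> (b \<otimes> s))"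
  unfolding loc_frac_def using assms eq_equiv_class_iff[OF equiv_loc_rel, of "(a, s)" "(b, t)"]
  by (auto simp: loc_rel_def)

lemma loc_frac_eqI:
  assumes "a \<in> carrier R" "b \<in> carrier R" "s \<in> S" "t \<in> S" "a \<otimes> t = b \<otimes> s"
  shows "loc_frac R S a s = loc_frac R S b t"
  using assms loc_frac_eq_iff one_closed by metis

lemma carrier_localization:
  "carrier (localization R S) = {loc_frac R S a s | a s. a \<in> carrier R \<and> s \<in> S}"
  by (auto simp: localization_def quotient_def loc_frac_def)

lemma mem_loc_frac:
  assumes "a \<in> carrier R" "s \<in> S"
  shows "(b, t) \<in> loc_frac R S a s \<longleftrightarrow> b \<in> carrier R \<and> t \<in> S \<and> loc_frac R S b t = loc_frac R S a s"
  using assms loc_frac_eq_iff[of a b s t] by (auto simp: loc_frac_def loc_rel_def)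

lemma loc_frac_self: "a \<in> carrier R \<Longrightarrow> s \<in> S \<Longrightarrow> (a, s) \<in> loc_frac R S a s"
  by (simp add: mem_loc_frac)

lemma loc_mult_frac:
  assumes c [simp]: "a \<in> carrier R" "b \<in> carrier R" "s \<in> S" "t \<in> S"
  shows "loc_frac R S a s \<otimes>\<^bsub>localization R S\<^esub> loc_frac R S b t = loc_frac R S (a \<otimes> b) (s \<otimes> t)"
proof -
  have "loc_frac R S (a' \<otimes> b') (s' \<otimes> t') = loc_frac R S (a \<otimes> b) (s \<otimes> t)"
    if m: "(a', s') \<in> loc_frac R S a s" "(b', t') \<in> loc_frac R S b t" for a' s' b' t'
  proof -
    from m have [simp]: "a' \<in> carrier R" "b' \<in> carrier R" "s' \<in> S" "t' \<in> S"
      and e: "loc_frac R S a' s' = loc_frac R S a s" "loc_frac R S b' t' = loc_frac R S b t"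
      by (auto simp: mem_loc_frac)
    from e obtain u w where [simp]: "u \<in> S" "w \<in> S"
      and u: "u \<otimes> (a' \<otimes> s) = u \<otimes> (a \<otimes> s')" and w: "w \<otimes> (b' \<otimes> t) = w \<otimes> (b \<otimes> t')"
      by (auto simp: loc_frac_eq_iff)
    have "(u \<otimes> w) \<otimes> ((a' \<otimes> b') \<otimes> (s \<otimes> t)) = (u \<otimes> (a' \<otimes> s)) \<otimes> (w \<otimes> (b' \<otimes> t))"
      by (simp add: m_ac)
    also have "\<dots> = (u \<otimes> w) \<otimes> ((a \<otimes> b) \<otimes> (s' \<otimes> t'))"
      unfolding u w by (simp add: m_ac)
    finally show ?thesis
      by (subst loc_frac_eq_iff) (auto intro!: bexI[of _ "u \<otimes> w"])
  qed
  then have "(\<Union>x\<in>loc_frac R S a s. \<Union>y\<in>loc_frac R S b t.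
      case (x, y) of ((a', s'), (b', t')) \<Rightarrow> loc_frac R S (a' \<otimes> b') (s' \<otimes> t'))
    = (\<Union>x\<in>loc_frac R S a s. \<Union>y\<in>loc_frac R S b t. loc_frac R S (a \<otimes> b) (s \<otimes> t))"
    by (intro SUP_cong refl) auto
  also have "\<dots> = loc_frac R S (a \<otimes> b) (s \<otimes> t)"
    using loc_frac_self[of a s] loc_frac_self[of b t] c by blast
  finally show ?thesis
    by (simp add: localization_def)
qed

lemma loc_add_frac:
  assumes c [simp]: "a \<in> carrier R" "b \<in> carrier R" "s \<in> S" "t \<in> S"
  shows "loc_frac R S a s \<oplus>\<^bsub>localization R S\<^esub> loc_frac R S b t
    = loc_frac R S (a \<otimes> t \<oplus> b \<otimes> s) (s \<otimes> t)"
proof -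
  have "loc_frac R S (a' \<otimes> t' \<oplus> b' \<otimes> s') (s' \<otimes> t') = loc_frac R S (a \<otimes> t \<oplus> b \<otimes> s) (s \<otimes> t)"
    if m: "(a', s') \<in> loc_frac R S a s" "(b', t') \<in> loc_frac R S b t" for a' s' b' t'
  proof -
    from m have [simp]: "a' \<in> carrier R" "b' \<in> carrier R" "s' \<in> S" "t' \<in> S"
      and e: "loc_frac R S a' s' = loc_frac R S a s" "loc_frac R S b' t' = loc_frac R S b t"
      by (auto simp: mem_loc_frac)
    from e obtain u w where [simp]: "u \<in> S" "w \<in> S"
      and u: "u \<otimes> (a' \<otimes> s) = u \<otimes> (a \<otimes> s')" and w: "w \<otimes> (b' \<otimes> t) = w \<otimes> (b \<otimes> t')"
      by (auto simp: loc_frac_eq_iff)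
    have "(u \<otimes> w) \<otimes> ((a' \<otimes> t' \<oplus> b' \<otimes> s') \<otimes> (s \<otimes> t))
        = (w \<otimes> t \<otimes> t') \<otimes> (u \<otimes> (a' \<otimes> s)) \<oplus> (u \<otimes> s \<otimes> s') \<otimes> (w \<otimes> (b' \<otimes> t))"
      by (simp add: m_ac l_distr r_distr)
    also have "\<dots> = (u \<otimes> w) \<otimes> ((a \<otimes> t \<oplus> b \<otimes> s) \<otimes> (s' \<otimes> t'))"
      unfolding u w by (simp add: m_ac l_distr r_distr)
    finally show ?thesis
      by (subst loc_frac_eq_iff) (auto intro!: bexI[of _ "u \<otimes> w"])
  qed
  then have "(\<Union>x\<in>loc_frac R S a s. \<Union>y\<in>loc_frac R S b t.
      case (x, y) of ((a', s'), (b', t')) \<Rightarrow> loc_frac R S (a' \<otimes> t' \<oplus> b' \<otimes> s') (s' \<otimes> t'))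
    = (\<Union>x\<in>loc_frac R S a s. \<Union>y\<in>loc_frac R S b t. loc_frac R S (a \<otimes> t \<oplus> b \<otimes> s) (s \<otimes> t))"
    by (intro SUP_cong refl) auto
  also have "\<dots> = loc_frac R S (a \<otimes> t \<oplus> b \<otimes> s) (s \<otimes> t)"
    using loc_frac_self[of a s] loc_frac_self[of b t] c by blast
  finally show ?thesis
    by (simp add: localization_def)
qed

lemma loc_one: "\<one>\<^bsub>localization R S\<^esub> = loc_frac R S \<one> \<one>"
  and loc_zero: "\<zero>\<^bsub>localization R S\<^esub> = loc_frac R S \<zero> \<one>"
  by (simp_all add: localization_def)

lemma localization_cases:
  assumes "x \<in> carrier (localization R S)"
  obtains a s where "x = loc_frac R S a s" "a \<in> carrier R" "s \<in> S"
  using assms by (auto simp: carrier_localization)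

lemma loc_frac_closed [simp]:
  "a \<in> carrier R \<Longrightarrow> s \<in> S \<Longrightarrow> loc_frac R S a s \<in> carrier (localization R S)"
  by (auto simp: carrier_localization)

lemma cring_localization: "cring (localization R S)"
proof (rule cringI)
  note simps = loc_mult_frac loc_add_frac loc_one loc_zero
  show "abelian_group (localization R S)"
  proof (rule abelian_groupI)
    fix x y
    assume "x \<in> carrier (localization R S)" "y \<in> carrier (localization R S)"
    then show "x \<oplus>\<^bsub>localization R S\<^esub> y \<in> carrier (localization R S)"
      by (elim localization_cases) (simp add: simps)
  next
    show "\<zero>\<^bsub>localization R S\<^esub> \<in> carrier (localization R S)"
      by (simp add: simps)
  next
    fix x y z
    assume "x \<in> carrier (localization R S)" "y \<in> carrier (localization R S)"
      "z \<in> carrier (localization R S)"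
    then show "x \<oplus>\<^bsub>localization R S\<^esub> y \<oplus>\<^bsub>localization R S\<^esub> z
        = x \<oplus>\<^bsub>localization R S\<^esub> (y \<oplus>\<^bsub>localization R S\<^esub> z)"
      by (elim localization_cases) (simp add: simps m_ac a_ac l_distr r_distr)
  next
    fix x y
    assume "x \<in> carrier (localization R S)" "y \<in> carrier (localization R S)"
    then show "x \<oplus>\<^bsub>localization R S\<^esub> y = y \<oplus>\<^bsub>localization R S\<^esub> x"
      by (elim localization_cases) (simp add: simps m_ac a_ac)
  next
    fix x
    assume "x \<in> carrier (localization R S)"
    then show "\<zero>\<^bsub>localization R S\<^esub> \<oplus>\<^bsub>localization R S\<^esub> x = x"
      by (elim localization_cases) (simp add: simps)
  next
    fix x assume "x \<in> carrier (localization R S)"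
    then obtain a s where x: "x = loc_frac R S a s" and [simp]: "a \<in> carrier R" "s \<in> S"
      by (rule localization_cases)
    have "loc_frac R S (\<ominus> a \<otimes> s \<oplus> a \<otimes> s) (s \<otimes> s) = loc_frac R S \<zero> \<one>"
      by (rule loc_frac_eqI) (simp_all add: l_minus l_neg)
    then have "loc_frac R S (\<ominus> a) s \<oplus>\<^bsub>localization R S\<^esub> x = \<zero>\<^bsub>localization R S\<^esub>"
      by (simp add: x simps)
    then show "\<exists>y\<in>carrier (localization R S). y \<oplus>\<^bsub>localization R S\<^esub> x = \<zero>\<^bsub>localization R S\<^esub>"
      by (intro bexI[of _ "loc_frac R S (\<ominus> a) s"]) simp_all
  qed
  show "comm_monoid (localization R S)"
  proof (rule comm_monoidI)
    fix x y
    assume "x \<in> carrier (localization R S)" "y \<in> carrier (localization R S)"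
    then show "x \<otimes>\<^bsub>localization R S\<^esub> y \<in> carrier (localization R S)"
      by (elim localization_cases) (simp add: simps)
  next
    show "\<one>\<^bsub>localization R S\<^esub> \<in> carrier (localization R S)"
      by (simp add: simps)
  next
    fix x y z
    assume "x \<in> carrier (localization R S)" "y \<in> carrier (localization R S)"
      "z \<in> carrier (localization R S)"
    then show "x \<otimes>\<^bsub>localization R S\<^esub> y \<otimes>\<^bsub>localization R S\<^esub> z
        = x \<otimes>\<^bsub>localization R S\<^esub> (y \<otimes>\<^bsub>localization R S\<^esub> z)"
      by (elim localization_cases) (simp add: simps m_assoc)
  next
    fix x
    assume "x \<in> carrier (localization R S)"
    then show "\<one>\<^bsub>localization R S\<^esub> \<otimes>\<^bsub>localization R S\<^esub> x = x"
      by (elim localization_cases) (simp add: simps)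
  next
    fix x y
    assume "x \<in> carrier (localization R S)" "y \<in> carrier (localization R S)"
    then show "x \<otimes>\<^bsub>localization R S\<^esub> y = y \<otimes>\<^bsub>localization R S\<^esub> x"
      by (elim localization_cases) (simp add: simps m_comm)
  qed
  fix x y z
  assume "x \<in> carrier (localization R S)" "y \<in> carrier (localization R S)"
    "z \<in> carrier (localization R S)"
  then show "(x \<oplus>\<^bsub>localization R S\<^esub> y) \<otimes>\<^bsub>localization R S\<^esub> z
      = x \<otimes>\<^bsub>localization R S\<^esub> z \<oplus>\<^bsub>localization R S\<^esub> y \<otimes>\<^bsub>localization R S\<^esub> z"
    by (elim localization_cases) (simp add: simps, rule loc_frac_eqI, simp_all add: m_ac l_distr r_distr)
qed

end


section \<open>Krull dimension, reductions and the core\<close>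

text \<open>
  Supremum of the lengths \<open>n\<close> of chains \<open>p 0 \<subset> \<dots> \<subset> p n\<close> of prime ideals.  The zero ring
  has no prime ideals, so its dimension is \<open>Sup {} = -\<infinity>\<close>.
\<close>

definition krull_dim :: "('a, 'b) ring_scheme \<Rightarrow> ereal"
  where "krull_dim R =
    Sup {ereal (real n) | n. \<exists>p :: nat \<Rightarrow> 'a set.
           (\<forall>i\<le>n. primeideal (p i) R) \<and> (\<forall>i<n. p i \<subset> p (Suc i))}"

definition zero_dimensional :: "('a, 'b) ring_scheme \<Rightarrow> 'a set \<Rightarrow> bool"
  where "zero_dimensional R I \<longleftrightarrow> ideal I R \<and> krull_dim (R Quot I) = 0"

text \<open>Powers of ideals are taken in the monoid \<open>ideals_set R\<close>; in particular \<open>I\<^sup>0 = R\<close>.\<close>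

definition is_reduction :: "('a, 'b) ring_scheme \<Rightarrow> 'a set \<Rightarrow> 'a set \<Rightarrow> bool"
  where "is_reduction R J I \<longleftrightarrow> ideal J R \<and> J \<subseteq> I \<and>
    (\<exists>r::nat. I [^]\<^bsub>ideals_set R\<^esub> (r + 1) = J \<cdot>\<^bsub>R\<^esub> (I [^]\<^bsub>ideals_set R\<^esub> r))"

definition core :: "('a, 'b) ring_scheme \<Rightarrow> 'a set \<Rightarrow> 'a set"
  where "core R I = \<Inter> {J. is_reduction R J I}"

end

theory Submission
  imports Defs "HOL-Algebra.Subrings"
begin

text \<open>
  A reduction \<open>K\<close> of \<open>S\<inverse>I\<close> contracts to the reduction \<open>K \<inter> I\<close> of \<open>I\<close>: at the maximal ideals above
  \<open>I\<close> that survive in \<open>S\<inverse>R\<close> this is clear, and at the others \<open>K \<inter> I\<close> coincides with \<open>I\<close>.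
  Concretely, as \<open>R/I\<close> is zero-dimensional, each \<open>t \<in> S\<close> satisfies
  \<open>t\<^sup>k (1 - t b) \<in> I\<^sup>n\<close> for suitable \<open>k\<close> and \<open>b\<close>.  This gives \<open>S\<inverse>core(I) \<subseteq> core(S\<inverse>I)\<close>.

  For the other inclusion, an element of \<open>core(S\<inverse>I)\<close> has a denominator for each reduction \<open>J\<close>
  of \<open>I\<close>, and these have to be chosen independently of \<open>J\<close>.  This is possible because some
  power \<open>I\<^sup>N\<close> lies in all reductions of \<open>I\<close>.  To find \<open>N\<close>, observe that modulo \<open>I\<^sup>2\<close> every reduction
  is generated by at most \<open>g\<close> elements, \<open>g\<close> being the length of \<open>R/I\<^sup>2\<close>.  Write such elements as
  combinations of fixed generators of \<open>I\<close> and consider the generic ones, whose coefficients are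
  indeterminates.  Over the (Noetherian) ring of polynomial functions \<open>B\<close> in these coefficients
  they generate an ideal \<open>V\<close>, and the ideals \<open>a\<^sub>r = (V I\<^sup>r + I\<^sup>r\<^sup>+\<^sup>2 : I\<^sup>r\<^sup>+\<^sup>1)\<close> of \<open>B\<close> ascend, hence become
  stationary.  By Nakayama's lemma, a specialization of \<open>V\<close> is a reduction (modulo \<open>I\<^sup>r\<^sup>+\<^sup>2\<close>) with
  exponent \<open>r\<close> if and only if some element of \<open>a\<^sub>r\<close> takes the value \<open>1\<close> there, so that one exponent works for all.
\<close>

section \<open>Prime ideals in Noetherian rings\<close>

lemma (in cring) cring_idealI:
  assumes "A \<subseteq> carrier R" "\<zero> \<in> A"
    and "\<And>a b. \<lbrakk>a \<in> A; b \<in> A\<rbrakk> \<Longrightarrow> a \<oplus> b \<in> A"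
    and "\<And>a r. \<lbrakk>a \<in> A; r \<in> carrier R\<rbrakk> \<Longrightarrow> r \<otimes> a \<in> A"
  shows "ideal A R"
proof (rule idealI)
  show "ring R" by (rule ring_axioms)
  show "subgroup A (add_monoid R)"
  proof (rule add.subgroupI)
    show "A \<subseteq> carrier R" "A \<noteq> {}" using assms(1,2) by auto
    fix a assume a: "a \<in> A"
    then have "\<ominus> \<one> \<otimes> a \<in> A" by (intro assms(4)) auto
    then show "\<ominus> a \<in> A" using a assms(1) by (simp add: l_minus subset_iff)
  next
    fix a b assume "a \<in> A" "b \<in> A" then show "a \<oplus> b \<in> A" by (rule assms(3))
  qed
  fix a x assume a: "a \<in> A" "x \<in> carrier R"
  then show "x \<otimes> a \<in> A" by (rule assms(4))
  then show "a \<otimes> x \<in> A" using a assms(1) by (metis m_comm subsetD)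
qed

lemma (in ideal) ideal_minus_closed:
  assumes "a \<in> I" "b \<in> I" shows "a \<ominus> b \<in> I"
  using assms by (simp add: minus_eq)

text \<open>The ideal is the sum of \<open>P\<close> and the principal ideal of \<open>a\<close>.
  Only its inclusions and the shape of its elements are exported, as maximality arguments use just
  these.\<close>

lemma (in cring) ideal_insert:
  assumes P: "ideal P R" and a: "a \<in> carrier R"
  obtains J where "ideal J R" "P \<subseteq> J" "a \<in> J"
    "\<And>x. x \<in> J \<Longrightarrow> \<exists>p\<in>P. \<exists>r\<in>carrier R. x = p \<oplus> r \<otimes> a"
proof -
  interpret P: ideal P R by (rule P)
  define J where "J = {x. \<exists>p\<in>P. \<exists>r\<in>carrier R. x = p \<oplus> r \<otimes> a}"
  have [simp]: "p \<in> P \<Longrightarrow> p \<in> carrier R" for p by (rule P.Icarr)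
  have memI: "x \<in> J" if "p \<in> P" "r \<in> carrier R" "x = p \<oplus> r \<otimes> a" for x p r
    using that unfolding J_def by blast
  have "ideal J R"
  proof (rule cring_idealI)
    show "J \<subseteq> carrier R" unfolding J_def using a by auto
    show "\<zero> \<in> J" by (rule memI[of \<zero> \<zero>]) (use a in auto)
  next
    fix x y assume "x \<in> J" "y \<in> J"
    then obtain p r p' r' where *: "p \<in> P" "r \<in> carrier R" "x = p \<oplus> r \<otimes> a"
      "p' \<in> P" "r' \<in> carrier R" "y = p' \<oplus> r' \<otimes> a" unfolding J_def by blast
    show "x \<oplus> y \<in> J"
      by (rule memI[of "p \<oplus> p'" "r \<oplus> r'"]) (use * a in \<open>auto simp: l_distr a_ac\<close>)
  next
    fix x s assume "x \<in> J" "s \<in> carrier R"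
    then obtain p r where *: "p \<in> P" "r \<in> carrier R" "x = p \<oplus> r \<otimes> a" unfolding J_def by blast
    show "s \<otimes> x \<in> J"
      by (rule memI[of "s \<otimes> p" "s \<otimes> r"])
        (use * a \<open>s \<in> carrier R\<close> in \<open>auto simp: r_distr m_assoc P.I_l_closed\<close>)
  qed
  moreover have "P \<subseteq> J"
  proof
    fix p assume "p \<in> P" then show "p \<in> J" by (intro memI[of p \<zero>]) (use a in auto)
  qed
  moreover have "a \<in> J" by (rule memI[of \<zero> \<one>]) (use a in auto)
  ultimately show thesis using that unfolding J_def by blast
qed

text \<open>The union of a nonempty chain of ideals in a Noetherian ring already belongs to the
  chain, so Zorn's lemma applies to every inhabited property \<open>Q\<close> of ideals.\<close>

lemma (in noetherian_ring) ideals_maximal_element: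
  assumes "Q J0" "\<And>J. Q J \<Longrightarrow> ideal J R"
  obtains M where "Q M" "\<And>J. \<lbrakk>Q J; M \<subseteq> J\<rbrakk> \<Longrightarrow> J = M"
proof -
  have "\<exists>M\<in>Collect Q. \<forall>J\<in>Collect Q. M \<subseteq> J \<longrightarrow> J = M"
  proof (rule subset_Zorn)
    fix C assume C: "subset.chain (Collect Q) C"
    show "\<exists>U\<in>Collect Q. \<forall>X\<in>C. X \<subseteq> U"
    proof (cases "C = {}")
      case True then show ?thesis using assms(1) by auto
    next
      case False
      have "subset.chain {I. ideal I R} C" using C assms(2) unfolding pred_on.chain_def by auto
      then have "\<Union>C \<in> C" using ideal_chain_is_trivial False by blast
      then show ?thesis using C unfolding pred_on.chain_def by (meson Union_upper subsetD)
    qed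
  qed
  then show thesis using that by auto
qed

lemma (in noetherian_ring) ascending_ideals_stable:
  fixes a :: "nat \<Rightarrow> 'a set"
  assumes "\<And>n. ideal (a n) R" "\<And>n. a n \<subseteq> a (Suc n)"
  obtains N where "\<And>n. n \<ge> N \<Longrightarrow> a n = a N"
proof -
  obtain M where M: "M \<in> range a" and mx: "\<And>J. \<lbrakk>J \<in> range a; M \<subseteq> J\<rbrakk> \<Longrightarrow> J = M"
    by (rule ideals_maximal_element[of "\<lambda>J. J \<in> range a" "a 0"]) (use assms(1) in auto)
  then obtain N where "M = a N" by blast
  then show thesis using that mx lift_Suc_mono_le[of a] assms(2) by (metis rangeI)
qed

locale noetherian_cring = cring + noetherian_ring

text \<open>An ideal \<open>P\<close> maximal among those containing \<open>I\<close> and missing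
  \<open>T\<close> is prime: if \<open>a\<close> and \<open>b\<close> lie outside \<open>P\<close>,
  then P + (a) and P + (b) both meet \<open>T\<close>, and the product of two such elements of
  \<open>T\<close> would lie in \<open>P\<close> if ab did.\<close>

lemma (in noetherian_cring) exists_prime_disjoint:
  assumes I: "ideal I R" and T: "submonoid T R" and disj: "I \<inter> T = {}"
  obtains P where "primeideal P R" "I \<subseteq> P" "P \<inter> T = {}"
proof -
  interpret T: submonoid T R by (rule T)
  define F where "F J \<longleftrightarrow> ideal J R \<and> I \<subseteq> J \<and> J \<inter> T = {}" for J
  have "F I" using I disj unfolding F_def by blast
  then obtain P where P: "F P" and mx: "\<And>J. \<lbrakk>F J; P \<subseteq> J\<rbrakk> \<Longrightarrow> J = P"
    by (rule ideals_maximal_element) (auto simp: F_def)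
  interpret P: ideal P R using P unfolding F_def by auto
  have ex: "\<exists>t\<in>T. \<exists>p\<in>P. \<exists>r\<in>carrier R. t = p \<oplus> r \<otimes> a" if a: "a \<in> carrier R" "a \<notin> P" for a
  proof -
    obtain J where J: "ideal J R" "P \<subseteq> J" "a \<in> J"
      and Jx: "\<And>x. x \<in> J \<Longrightarrow> \<exists>p\<in>P. \<exists>r\<in>carrier R. x = p \<oplus> r \<otimes> a"
      using ideal_insert[OF P.is_ideal a(1)] by blast
    have "\<not> F J" using mx[of J] J a(2) by blast
    then obtain t where "t \<in> T" "t \<in> J" using J P unfolding F_def by blast
    then show ?thesis using Jx by blast
  qed
  have "primeideal P R"
  proof (rule primeidealI)
    show "carrier R \<noteq> P" using P T.one_closed unfolding F_def by auto
    fix a b assume ab: "a \<in> carrier R" "b \<in> carrier R" "a \<otimes> b \<in> P"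
    show "a \<in> P \<or> b \<in> P"
    proof (rule ccontr)
      assume "\<not> ?thesis"
      then obtain t p r t' p' r' where t: "t \<in> T" "p \<in> P" "r \<in> carrier R" "t = p \<oplus> r \<otimes> a"
          "t' \<in> T" "p' \<in> P" "r' \<in> carrier R" "t' = p' \<oplus> r' \<otimes> b"
        using ex ab by meson
      have "t \<otimes> t' = p \<otimes> t' \<oplus> (r \<otimes> a) \<otimes> p' \<oplus> (r \<otimes> r') \<otimes> (a \<otimes> b)"
        unfolding t using t(2,3,6,7) ab by (simp add: l_distr r_distr m_ac a_ac)
      also have "\<dots> \<in> P"
      proof (intro P.a_closed)
        show "p \<otimes> t' \<in> P" using t(2,5) by (intro P.I_r_closed) auto
        show "(r \<otimes> a) \<otimes> p' \<in> P" "(r \<otimes> r') \<otimes> (a \<otimes> b) \<in> P"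
          using t(3,6,7) ab by (auto intro: P.I_l_closed)
      qed
      finally show False using T.m_closed[OF t(1,5)] P unfolding F_def by blast
    qed
  qed (auto intro: P.is_ideal is_cring)
  then show thesis using that P unfolding F_def by blast
qed

lemma (in noetherian_cring) exists_prime_above:
  assumes I: "ideal I R" "I \<noteq> carrier R"
  obtains P where "primeideal P R" "I \<subseteq> P"
proof -
  have "submonoid {\<one>} R" by unfold_locales auto
  moreover have "I \<inter> {\<one>} = {}" using ideal.one_imp_carrier[OF I(1)] I(2) by blast
  ultimately show thesis using exists_prime_disjoint[OF I(1)] that by metis
qed

section \<open>Zero-dimensionality as a condition on prime ideals\<close>

text \<open>This amounts to dim R/I \<le> 0, the unit ideal included. Unlike dimension exactly 0 it
  passes to every larger ideal, as the Noetherian induction for bounded generation requires.\<close>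

definition primes_above_maximal :: "('a, 'b) ring_scheme \<Rightarrow> 'a set \<Rightarrow> bool"
  where "primes_above_maximal R I \<longleftrightarrow> (\<forall>P. primeideal P R \<and> I \<subseteq> P \<longrightarrow> maximalideal P R)"

lemma (in cring) primeideal_image_Quot:
  assumes I: "ideal I R" and P: "primeideal P R" "I \<subseteq> P"
  shows "primeideal ((+>) I ` P) (R Quot I)"
proof -
  interpret I: ideal I R by (rule I)
  interpret P: primeideal P R by (rule P)
  interpret h: ring_hom_ring R "R Quot I" "(+>) I" by (rule I.rcos_ring_hom_ring)
  have id: "ideal ((+>) I ` P) (R Quot I)" by (rule ring_ideal_imp_quot_ideal[OF I P.is_ideal])
  \<comment> \<open>Because \<open>I \<subseteq> P\<close>, the preimage of the image of
    \<open>P\<close> is \<open>P\<close> again; properness and primality are transferred through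
    this.\<close>
  have mem: "x \<in> P" if "x \<in> carrier R" "I +> x \<in> (+>) I ` P" for x
  proof -
    from that obtain p where p: "p \<in> P" "I +> x = I +> p" by blast
    then have "x \<in> I +> p" using I.a_rcos_self[OF that(1)] by simp
    then show ?thesis using p P(2) unfolding a_r_coset_def' by (auto intro: P.a_closed)
  qed
  show ?thesis
  proof (rule primeidealI[OF id I.quotient_is_cring[OF is_cring]])
    show "carrier (R Quot I) \<noteq> (+>) I ` P"
    proof
      assume "carrier (R Quot I) = (+>) I ` P"
      then have "\<one> \<in> P" by (intro mem) (metis h.hom_closed one_closed, metis h.hom_closed one_closed)
      then show False using P.I_notcarr P.one_imp_carrier by simp
    qed
  next
    fix a b assume ab: "a \<in> carrier (R Quot I)" "b \<in> carrier (R Quot I)" "a \<otimes>\<^bsub>R Quot I\<^esub> b \<in> (+>) I ` P"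
    then obtain x y where xy: "x \<in> carrier R" "a = I +> x" "y \<in> carrier R" "b = I +> y"
      unfolding FactRing_def A_RCOSETS_def' by auto
    then have "x \<otimes> y \<in> P" using ab(3) mem[of "x \<otimes> y"] by (metis h.hom_mult m_closed)
    then have "x \<in> P \<or> y \<in> P" using P.I_prime xy by blast
    then show "a \<in> (+>) I ` P \<or> b \<in> (+>) I ` P" using xy by blast
  qed
qed

text \<open>A prime \<open>P\<close> above \<open>I\<close> that is not maximal lies properly inside
  a second prime \<open>Q\<close>. By the correspondence of ideals their images stay distinct, so
  they form a chain of length 1 in R/I, contradicting dimension 0.\<close>

lemma (in noetherian_cring) zero_dimensional_primes_above_maximal:
  assumes zd: "zero_dimensional R I"
  shows "primes_above_maximal R I"
  unfolding primes_above_maximal_def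
proof (intro allI impI, elim conjE)
  fix P assume P: "primeideal P R" "I \<subseteq> P"
  interpret P: primeideal P R by (rule P)
  have I: "ideal I R" using zd unfolding zero_dimensional_def by simp
  show "maximalideal P R"
  proof (rule maximalidealI)
    fix J assume J: "ideal J R" "P \<subseteq> J" "J \<subseteq> carrier R"
    show "J = P \<or> J = carrier R"
    proof (rule ccontr)
      assume n: "\<not> ?thesis"
      then obtain Q where Q: "primeideal Q R" "J \<subseteq> Q" using exists_prime_above[OF J(1)] by blast
      \<comment> \<open>A chain of length 1 uses only \<open>p 0\<close> and \<open>p 1\<close>; the
        later values merely repeat the image of \<open>Q\<close>.\<close>
      define p where "p i = (+>) I ` (if i = 0 then P else Q)" for i :: nat
      have inj: "inj_on (\<lambda>J. (+>) I ` J) {J. ideal J R \<and> I \<subseteq> J}"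
        using quot_ideal_correspondence[OF I] by (rule bij_betw_imp_inj_on)
      have "(+>) I ` P \<noteq> (+>) I ` Q"
      proof
        assume "(+>) I ` P = (+>) I ` Q"
        then have "P = Q"
          using inj_onD[OF inj, of P Q] P(2) P.is_ideal J(2) Q(2) primeideal.axioms(1)[OF Q(1)] by auto
        then show False using J(2) Q(2) n by blast
      qed
      then have "p 0 \<subset> p (Suc 0)" unfolding p_def using J Q by auto
      moreover have "primeideal (p i) (R Quot I)" for i
        unfolding p_def using primeideal_image_Quot[OF I] P Q J by (cases "i = 0") auto
      ultimately have "ereal (real 1) \<le> krull_dim (R Quot I)"
        unfolding krull_dim_def by (intro Sup_upper) (auto intro!: exI[of _ p])
      then show False using zd unfolding zero_dimensional_def by simp
    qed
  qed (use P.is_ideal P.I_notcarr in auto)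
qed

text \<open>P + (a) is the whole ring, hence contains 1.\<close>

lemma (in cring) maximalideal_inverse:
  assumes P: "maximalideal P R" and a: "a \<in> carrier R" "a \<notin> P"
  obtains b where "b \<in> carrier R" "\<one> \<ominus> a \<otimes> b \<in> P"
proof -
  interpret P: maximalideal P R by (rule P)
  obtain J where J: "ideal J R" "P \<subseteq> J" "a \<in> J"
    and Jx: "\<And>x. x \<in> J \<Longrightarrow> \<exists>p\<in>P. \<exists>r\<in>carrier R. x = p \<oplus> r \<otimes> a"
    using ideal_insert[OF P.is_ideal a(1)] by blast
  have "J = carrier R" using P.I_maximal[OF J(1,2)] ideal.Icarr[OF J(1)] J(3) a(2) by blast
  then obtain p b where p: "p \<in> P" "b \<in> carrier R" "\<one> = p \<oplus> b \<otimes> a"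
    using Jx[of \<one>] by auto
  have "\<one> \<ominus> a \<otimes> b = (p \<oplus> b \<otimes> a) \<ominus> a \<otimes> b" by (subst p(3)) (rule refl)
  also have "\<dots> = p" using a p(2) P.Icarr[OF p(1)] by algebra
  finally have "\<one> \<ominus> a \<otimes> b = p" .
  then show thesis using that p by blast
qed

text \<open>The elements t^k (1 - tb) form a multiplicative set \<open>T\<close>. If it missed
  \<open>I\<close>, some prime \<open>P\<close> above \<open>I\<close> would miss it too. Then
  \<open>P\<close> does not contain \<open>t\<close> (take k = 1, b = 0), so \<open>t\<close> is
  invertible modulo the maximal ideal \<open>P\<close>, which puts some 1 - tb (the case k = 0) into
  \<open>P\<close>.\<close>

lemma (in noetherian_cring) power_one_minus_mem:
  assumes I: "ideal I R" and mx: "primes_above_maximal R I" and t: "t \<in> carrier R"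
  obtains k :: nat and b where "b \<in> carrier R" "t [^] k \<otimes> (\<one> \<ominus> t \<otimes> b) \<in> I"
proof -
  define T where "T = {t [^] k \<otimes> (\<one> \<ominus> t \<otimes> b) | (k::nat) b. b \<in> carrier R}"
  have "submonoid T R"
  proof
    show "T \<subseteq> carrier R" unfolding T_def using t by auto
    have "\<one> = t [^] (0::nat) \<otimes> (\<one> \<ominus> t \<otimes> \<zero>)" using t by (simp add: minus_eq)
    then show "\<one> \<in> T" unfolding T_def by blast
    fix x y assume "x \<in> T" "y \<in> T"
    then obtain k b k' b' where *: "x = t [^] (k::nat) \<otimes> (\<one> \<ominus> t \<otimes> b)" "b \<in> carrier R"
       "y = t [^] (k'::nat) \<otimes> (\<one> \<ominus> t \<otimes> b')" "b' \<in> carrier R" unfolding T_def by blast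
    have tk: "t [^] k \<in> carrier R" "t [^] k' \<in> carrier R" using t by auto
    have "(u \<otimes> (\<one> \<ominus> t \<otimes> b)) \<otimes> (v \<otimes> (\<one> \<ominus> t \<otimes> b')) = (u \<otimes> v) \<otimes> (\<one> \<ominus> t \<otimes> (b \<oplus> b' \<ominus> t \<otimes> (b \<otimes> b')))"
      if "u \<in> carrier R" "v \<in> carrier R" for u v using that *(2,4) t by algebra
    from this[OF tk] have "x \<otimes> y = t [^] (k + k') \<otimes> (\<one> \<ominus> t \<otimes> (b \<oplus> b' \<ominus> t \<otimes> (b \<otimes> b')))"
      unfolding * using t by (simp add: nat_pow_mult)
    then show "x \<otimes> y \<in> T" unfolding T_def using * t by blast
  qed
  have "I \<inter> T \<noteq> {}"
  proof
    assume "I \<inter> T = {}"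
    then obtain P where P: "primeideal P R" "I \<subseteq> P" "P \<inter> T = {}"
      using exists_prime_disjoint[OF I \<open>submonoid T R\<close>] by blast
    have "t = t [^] (1::nat) \<otimes> (\<one> \<ominus> t \<otimes> \<zero>)" using t by (simp add: minus_eq)
    then have "t \<notin> P" using P(3) unfolding T_def by blast
    moreover have "maximalideal P R" using mx P unfolding primes_above_maximal_def by blast
    ultimately obtain b where b: "b \<in> carrier R" "\<one> \<ominus> t \<otimes> b \<in> P"
      using maximalideal_inverse t by blast
    then have "\<one> \<ominus> t \<otimes> b = t [^] (0::nat) \<otimes> (\<one> \<ominus> t \<otimes> b)" using t by (simp add: minus_eq)
    then show False using b P(3) unfolding T_def by blast
  qed
  then show thesis using that unfolding T_def by blast
qed

section \<open>Powers of ideals and bounded generation\<close>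

lemma (in cring) genideal_mono:
  assumes "A \<subseteq> B" "B \<subseteq> carrier R" shows "Idl A \<subseteq> Idl B"
  using assms by (meson genideal_ideal genideal_minimal genideal_self order_trans)

lemma (in cring) ideal_colon:
  assumes "ideal I R" "a \<in> carrier R"
  shows "ideal {x \<in> carrier R. x \<otimes> a \<in> I} R"
proof -
  interpret I: ideal I R by fact
  show ?thesis
    by (rule cring_idealI) (use assms(2) in \<open>auto simp: l_distr m_assoc intro: I.I_l_closed\<close>)
qed

lemma (in cring) ideal_prod_subset:
  assumes "ideal K R" "\<And>i j. \<lbrakk>i \<in> I; j \<in> J\<rbrakk> \<Longrightarrow> i \<otimes> j \<in> K"
  shows "I \<cdot> J \<subseteq> K"
proof
  interpret K: ideal K R by fact
  fix x assume "x \<in> I \<cdot> J"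
  then show "x \<in> K" by induction (use assms(2) in auto)
qed

lemma ideal_prod_mono:
  assumes "I \<subseteq> I'" "J \<subseteq> J'"
  shows "I \<cdot>\<^bsub>R\<^esub> J \<subseteq> I' \<cdot>\<^bsub>R\<^esub> J'"
proof
  fix x assume "x \<in> I \<cdot>\<^bsub>R\<^esub> J"
  then show "x \<in> I' \<cdot>\<^bsub>R\<^esub> J'" by induction (use assms in \<open>auto intro: ideal_prod.intros\<close>)
qed

abbreviation ideal_pow :: "('a, 'b) ring_scheme \<Rightarrow> 'a set \<Rightarrow> nat \<Rightarrow> 'a set"
  where "ideal_pow R I n \<equiv> I [^]\<^bsub>ideals_set R\<^esub> n"

lemma (in cring) ideal_pow_0: "ideal_pow R I 0 = carrier R"
  by (simp add: ideals_set_def)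

lemma (in cring) ideal_pow_ideal: "ideal I R \<Longrightarrow> ideal (ideal_pow R I n) R"
  using monoid.nat_pow_closed[OF comm_monoid.axioms(1)[OF ideals_set_is_comm_monoid], of I n]
  by (simp add: ideals_set_def)

lemma (in cring) ideal_pow_Suc:
  assumes "ideal I R" shows "ideal_pow R I (Suc n) = I \<cdot> ideal_pow R I n"
proof -
  have "ideal_pow R I (Suc n) = ideal_pow R I n \<cdot> I"
    by (simp add: ideals_set_def)
  then show ?thesis using ideal_prod_commute[OF assms ideal_pow_ideal[OF assms]] by simp
qed

lemma (in cring) ideal_pow_Suc_subset:
  assumes "ideal I R" shows "ideal_pow R I (Suc n) \<subseteq> ideal_pow R I n"
  unfolding ideal_pow_Suc[OF assms] using ideal_prod_inter[OF assms ideal_pow_ideal[OF assms]] by blast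

lemma (in cring) ideal_pow_antimono:
  assumes "ideal I R" "m \<le> n" shows "ideal_pow R I n \<subseteq> ideal_pow R I m"
  using lift_Suc_antimono_le[of "ideal_pow R I", OF ideal_pow_Suc_subset[OF assms(1)] assms(2)] .

lemma (in cring) pow_mem_ideal_pow:
  assumes "ideal I R" "x \<in> I" shows "x [^] n \<in> ideal_pow R I n"
proof (induction n)
  case 0 show ?case unfolding ideal_pow_0 by simp
next
  case (Suc n)
  have "x [^] Suc n = x \<otimes> x [^] n"
    using ideal.Icarr[OF assms] by (simp add: m_comm)
  then show ?case unfolding ideal_pow_Suc[OF assms(1)] using Suc assms(2) by (metis ideal_prod.prod)
qed

lemma (in primeideal) pow_mem_imp_mem:
  assumes "x \<in> carrier R" "x [^] (n::nat) \<in> I" shows "x \<in> I"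
  using assms(2)
proof (induction n)
  case 0 then show ?case using I_notcarr one_imp_carrier by simp
next
  case (Suc n) then show ?case using I_prime[of "x [^] n" x] assms(1) by auto
qed

text \<open>A prime containing I^n contains x^n, and hence x, for every x in \<open>I\<close>; so it
  already lies above \<open>I\<close>.\<close>

lemma (in cring) primes_above_maximal_pow:
  assumes "ideal I R" "primes_above_maximal R I"
  shows "primes_above_maximal R (ideal_pow R I n)"
  unfolding primes_above_maximal_def
proof (intro allI impI, elim conjE)
  fix P assume P: "primeideal P R" "ideal_pow R I n \<subseteq> P"
  have "I \<subseteq> P"
    using pow_mem_ideal_pow[OF assms(1)] P(2) primeideal.pow_mem_imp_mem[OF P(1)]
      ideal.Icarr[OF assms(1)] by blast
  then show "maximalideal P R" using assms(2) P(1) unfolding primes_above_maximal_def by blast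
qed

section \<open>Associated primes and finite length\<close>

text \<open>The ideal found is an associated prime of R/M, taken as a maximal one among the colon
  ideals (M : a) with \<open>a\<close> outside \<open>M\<close>. If \<open>y\<close> is not in (M :
  a), then (M : ya) contains (M : a) and so equals it; thus xy in (M : a) forces x in (M :
  a).\<close>

lemma (in noetherian_cring) exists_prime_colon:
  assumes M: "ideal M R" "M \<noteq> carrier R"
  obtains a where "a \<in> carrier R" "a \<notin> M" "primeideal {x \<in> carrier R. x \<otimes> a \<in> M} R"
proof -
  interpret M: ideal M R by fact
  define F where "F J \<longleftrightarrow> (\<exists>a\<in>carrier R - M. J = {x \<in> carrier R. x \<otimes> a \<in> M})" for J
  obtain a0 where "a0 \<in> carrier R - M" using M(2) M.Icarr by blast
  then have "F {x \<in> carrier R. x \<otimes> a0 \<in> M}" unfolding F_def by blast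
  then obtain Q where "F Q" and mx: "\<And>J. \<lbrakk>F J; Q \<subseteq> J\<rbrakk> \<Longrightarrow> J = Q"
    by (rule ideals_maximal_element) (auto simp: F_def intro: ideal_colon[OF M(1)])
  then obtain a where Q: "Q = {x \<in> carrier R. x \<otimes> a \<in> M}" "a \<in> carrier R" "a \<notin> M"
    unfolding F_def by blast
  have "primeideal Q R"
  proof (rule primeidealI)
    show "ideal Q R" unfolding Q(1) by (rule ideal_colon[OF M(1) Q(2)])
    show "carrier R \<noteq> Q" using Q one_closed by (metis (no_types, lifting) l_one mem_Collect_eq)
    fix x y assume xy: "x \<in> carrier R" "y \<in> carrier R" "x \<otimes> y \<in> Q"
    show "x \<in> Q \<or> y \<in> Q"
    proof (rule disjCI)
      assume "y \<notin> Q"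
      then have y: "y \<otimes> a \<notin> M" using Q(1) xy(2) by blast
      let ?J = "{x \<in> carrier R. x \<otimes> (y \<otimes> a) \<in> M}"
      have "F ?J" unfolding F_def using y xy(2) Q(2) by blast
      moreover have "Q \<subseteq> ?J"
      proof
        fix z assume "z \<in> Q"
        then have z: "z \<in> carrier R" "z \<otimes> a \<in> M" using Q(1) by auto
        then have "y \<otimes> (z \<otimes> a) \<in> M" using xy(2) by (metis M.I_l_closed)
        then show "z \<in> ?J" using z(1) m_lcomm[OF xy(2) z(1) Q(2)] by simp
      qed
      ultimately have "?J = Q" by (rule mx)
      moreover have "x \<in> ?J" using xy Q by (simp add: m_assoc)
      ultimately show "x \<in> Q" by blast
    qed
  qed (rule is_cring)
  then show thesis using that Q by blast
qed

text \<open>If every prime above \<open>M\<close> is maximal, then \<open>R / M\<close> has finite length, and the bound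
  obtained here is that length.\<close>

lemma (in noetherian_cring) bounded_generation_mod:
  assumes "ideal M R" "primes_above_maximal R M"
  obtains g :: nat where "\<And>N. ideal N R \<Longrightarrow>
    \<exists>h. h ` {..<g} \<subseteq> N \<and> N \<subseteq> Idl (h ` {..<g} \<union> M)"
proof -
  define bd where "bd M g \<longleftrightarrow> (\<forall>N. ideal N R \<longrightarrow>
    (\<exists>h. h ` {..<g} \<subseteq> N \<and> N \<subseteq> Idl (h ` {..<g} \<union> M)))" for M and g :: nat
  \<comment> \<open>\<open>F\<close> collects the counterexamples. A maximal one is refuted below,
    all larger ideals with only maximal primes above them having a bound.\<close>
  define F where "F M \<longleftrightarrow> ideal M R \<and> primes_above_maximal R M \<and> (\<forall>g. \<not> bd M g)" for M
  have nF: "\<not> F M0" for M0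
  proof
    assume "F M0"
    have "ideal J R" if "F J" for J using that unfolding F_def by simp
    with \<open>F M0\<close> obtain M where FM: "F M" and mx: "\<And>J. \<lbrakk>F J; M \<subseteq> J\<rbrakk> \<Longrightarrow> J = M"
      by (rule ideals_maximal_element) auto
    then have M: "ideal M R" "primes_above_maximal R M" "\<And>g. \<not> bd M g"
      unfolding F_def by simp_all
    interpret M: ideal M R by (rule M)
    have Mc: "M \<subseteq> carrier R" using M.Icarr by blast
    have "M \<noteq> carrier R"
    proof
      assume "M = carrier R"
      then have "bd M 0" unfolding bd_def using genideal_self[of "carrier R"]
        by (auto dest: ideal.Icarr)
      then show False using M(3) by blast
    qed
    then obtain a where a: "a \<in> carrier R" "a \<notin> M" and pr: "primeideal {x \<in> carrier R. x \<otimes> a \<in> M} R"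
      using exists_prime_colon[OF M(1)] by blast
    let ?Q = "{x \<in> carrier R. x \<otimes> a \<in> M}"
    have "M \<subseteq> ?Q" using Mc a M.I_r_closed by blast
    then have max: "maximalideal ?Q R" using pr M(2) unfolding primes_above_maximal_def by blast
    \<comment> \<open>\<open>K\<close> is M + (a), so K/M is isomorphic to R/(M : a), which is a
      field. As K/M is simple, one generator more than for \<open>K\<close> suffices.\<close>
    obtain K where K: "ideal K R" "M \<subseteq> K" "a \<in> K"
      and Kx: "\<And>x. x \<in> K \<Longrightarrow> \<exists>p\<in>M. \<exists>r\<in>carrier R. x = p \<oplus> r \<otimes> a"
      using ideal_insert[OF M(1) a(1)] by blast
    interpret K: ideal K R by (rule K)
    have "primes_above_maximal R K" using M(2) K(2) unfolding primes_above_maximal_def by blast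
    moreover have "\<not> F K" using mx[of K] K(2,3) a(2) by blast
    ultimately obtain g where g: "bd K g" using K(1) unfolding F_def by blast
    have "bd M (Suc g)" unfolding bd_def
    proof (intro allI impI)
      fix N assume N: "ideal N R"
      interpret N: ideal N R by (rule N)
      obtain h where h: "h ` {..<g} \<subseteq> N" "N \<subseteq> Idl (h ` {..<g} \<union> K)"
        using g N unfolding bd_def by blast
      have hc: "h ` {..<g} \<subseteq> carrier R" using h(1) N.Icarr by blast
      show "\<exists>h. h ` {..<Suc g} \<subseteq> N \<and> N \<subseteq> Idl (h ` {..<Suc g} \<union> M)"
      proof (cases "N \<inter> K \<subseteq> M")
        case True
        \<comment> \<open>As \<open>N\<close> meets \<open>K\<close> only inside \<open>M\<close>,
          elements of \<open>N\<close> that generate it modulo \<open>K\<close> also generate it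
          modulo \<open>M\<close>. Zero fills the additional slot.\<close>
        let ?h = "h(g := \<zero>)"
        have im: "?h ` {..<Suc g} = insert \<zero> (h ` {..<g})"
          by (auto simp: lessThan_Suc)
        define A where "A = Idl (insert \<zero> (h ` {..<g}) \<union> M)"
        have cc: "insert \<zero> (h ` {..<g}) \<union> M \<subseteq> carrier R" using hc Mc by auto
        interpret A: ideal A R unfolding A_def by (rule genideal_ideal[OF cc])
        have "x \<in> A" if x: "x \<in> N" for x
        proof -
          have hi: "ideal (Idl (h ` {..<g})) R" by (rule genideal_ideal[OF hc])
          have "h ` {..<g} \<union> K \<subseteq> Idl (h ` {..<g}) \<union> K" using genideal_self[OF hc] by blast
          then have "Idl (h ` {..<g} \<union> K) \<subseteq> Idl (Idl (h ` {..<g}) \<union> K)"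
            by (rule genideal_mono) (use K.Icarr ideal.Icarr[OF hi] in blast)
          then have "x \<in> Idl (h ` {..<g}) <+>\<^bsub>R\<^esub> K"
            using x h(2) union_genideal[OF hi K(1)] by blast
          then obtain y k where yk: "y \<in> Idl (h ` {..<g})" "k \<in> K" "x = y \<oplus> k"
            unfolding set_add_def' by auto
          have yN: "y \<in> N" using genideal_minimal[OF N h(1)] yk(1) by blast
          then have "k = x \<ominus> y" using yk K.Icarr N.Icarr x by algebra
          then have "k \<in> N" using x yN N.ideal_minus_closed by simp
          then have "k \<in> M" using yk True by blast
          then have "k \<in> A" unfolding A_def using genideal_self[OF cc] by blast
          moreover have "y \<in> A" unfolding A_def using yk(1) genideal_mono[of "h ` {..<g}", OF _ cc] by blast
          ultimately show "x \<in> A" using yk(3) by auto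
        qed
        moreover have "insert \<zero> (h ` {..<g}) \<subseteq> N" using h(1) by auto
        ultimately show ?thesis using im A_def by (intro exI[of _ ?h]) auto
      next
        case False
        then obtain n where n: "n \<in> N" "n \<in> K" "n \<notin> M" by blast
        \<comment> \<open>An element \<open>n\<close> of \<open>N \<inter> K\<close> outside
          \<open>M\<close> generates the simple module K/M, so adjoining it absorbs all of
          \<open>K\<close>.\<close>
        let ?h = "h(g := n)"
        have im: "?h ` {..<Suc g} = insert n (h ` {..<g})"
          by (auto simp: lessThan_Suc)
        define A where "A = Idl (insert n (h ` {..<g}) \<union> M)"
        have cc: "insert n (h ` {..<g}) \<union> M \<subseteq> carrier R" using hc Mc n(1) N.Icarr by auto
        interpret A: ideal A R unfolding A_def by (rule genideal_ideal[OF cc])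
        have sub: "insert n (h ` {..<g}) \<union> M \<subseteq> A" unfolding A_def by (rule genideal_self[OF cc])
        obtain p r where pr: "p \<in> M" "r \<in> carrier R" "n = p \<oplus> r \<otimes> a" using Kx n(2) by blast
        have "r \<otimes> a \<notin> M" using pr n(3) by auto
        then have "r \<notin> ?Q" by blast
        \<comment> \<open>An inverse \<open>b\<close> of \<open>r\<close> modulo the maximal ideal
          (M : a) recovers \<open>a\<close> from \<open>n\<close> up to elements of
          \<open>M\<close>.\<close>
        then obtain b where b: "b \<in> carrier R" "\<one> \<ominus> r \<otimes> b \<in> ?Q"
          using maximalideal_inverse[OF max pr(2)] by blast
        have "a = (\<one> \<ominus> r \<otimes> b) \<otimes> a \<oplus> b \<otimes> (n \<ominus> p)"
          unfolding pr(3) using pr(1,2) a(1) b(1) M.Icarr[OF pr(1)] by algebra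
        moreover have "(\<one> \<ominus> r \<otimes> b) \<otimes> a \<in> A" using b(2) sub by blast
        moreover have "b \<otimes> (n \<ominus> p) \<in> A"
          using b(1) sub pr(1) by (intro A.I_l_closed A.ideal_minus_closed) auto
        ultimately have aA: "a \<in> A" by (metis A.a_closed)
        have "K \<subseteq> A"
        proof
          fix x assume "x \<in> K"
          then obtain p r where "p \<in> M" "r \<in> carrier R" "x = p \<oplus> r \<otimes> a" using Kx by blast
          then show "x \<in> A" using aA sub A.I_l_closed by auto
        qed
        then have "Idl (h ` {..<g} \<union> K) \<subseteq> A" using sub by (intro genideal_minimal A.is_ideal) auto
        then have "N \<subseteq> A" using h(2) by blast
        moreover have "insert n (h ` {..<g}) \<subseteq> N" using h(1) n(1) by auto
        ultimately show ?thesis using im A_def by (intro exI[of _ ?h]) auto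
      qed
    qed
    then show False using M(3) by blast
  qed
  obtain g where "bd M g" using assms nF[of M] unfolding F_def by blast
  then show thesis using that unfolding bd_def by blast
qed

section \<open>Nakayama's lemma\<close>

text \<open>For ideals \<open>P\<close> and \<open>W\<close> this is the ideal W + P g_1 + ... + P
  g_n. No multiple of a generator by 1 is built in, which is what gives Nakayama's lemma its
  content.\<close>

primrec lin_span :: "('a, 'b) ring_scheme \<Rightarrow> 'a set \<Rightarrow> 'a set \<Rightarrow> 'a list \<Rightarrow> 'a set" where
  "lin_span R P W [] = W"
| "lin_span R P W (g # gs) = {p \<otimes>\<^bsub>R\<^esub> g \<oplus>\<^bsub>R\<^esub> y | p y. p \<in> P \<and> y \<in> lin_span R P W gs}"

context cring begin

lemma lin_span_ideal:
  assumes "ideal P R" "ideal W R" "set gs \<subseteq> carrier R"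
  shows "ideal (lin_span R P W gs) R"
  using assms(3)
proof (induction gs)
  case Nil then show ?case using assms(2) by simp
next
  case (Cons g gs)
  interpret P: ideal P R by fact
  interpret L: ideal "lin_span R P W gs" R using Cons by simp
  have g: "g \<in> carrier R" using Cons by simp
  have memI: "x \<in> lin_span R P W (g # gs)" if "p \<in> P" "y \<in> lin_span R P W gs" "x = p \<otimes> g \<oplus> y" for x p y
    using that by auto
  note [simp] = P.Icarr L.Icarr g
  show ?case
  proof (rule cring_idealI)
    show "lin_span R P W (g # gs) \<subseteq> carrier R" by auto
    show "\<zero> \<in> lin_span R P W (g # gs)" by (rule memI[of \<zero> \<zero>]) auto
  next
    fix a b assume "a \<in> lin_span R P W (g # gs)" "b \<in> lin_span R P W (g # gs)"
    then obtain p y q z where *: "p \<in> P" "y \<in> lin_span R P W gs" "a = p \<otimes> g \<oplus> y"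
        "q \<in> P" "z \<in> lin_span R P W gs" "b = q \<otimes> g \<oplus> z" by auto
    show "a \<oplus> b \<in> lin_span R P W (g # gs)"
      by (rule memI[of "p \<oplus> q" "y \<oplus> z"]) (use * in \<open>auto simp: l_distr a_ac\<close>)
  next
    fix a r assume "a \<in> lin_span R P W (g # gs)" "r \<in> carrier R"
    then obtain p y where *: "p \<in> P" "y \<in> lin_span R P W gs" "a = p \<otimes> g \<oplus> y" by auto
    show "r \<otimes> a \<in> lin_span R P W (g # gs)"
      by (rule memI[of "r \<otimes> p" "r \<otimes> y"])
        (use * \<open>r \<in> carrier R\<close> in \<open>auto simp: r_distr m_assoc P.I_l_closed L.I_l_closed\<close>)
  qed
qed

lemma lin_span_base:
  assumes "ideal P R" "ideal W R" "set gs \<subseteq> carrier R"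
  shows "W \<subseteq> lin_span R P W gs"
  using assms(3)
proof (induction gs)
  case (Cons g gs)
  interpret P: ideal P R by fact
  interpret W: ideal W R by fact
  have "x = \<zero> \<otimes> g \<oplus> x" if "x \<in> W" for x using Cons.prems W.Icarr[OF that] by simp
  moreover have "W \<subseteq> lin_span R P W gs" using Cons by simp
  ultimately show ?case unfolding lin_span.simps using P.zero_closed by blast
qed simp

lemma lin_span_mem:
  assumes "ideal P R" "ideal W R" "set gs \<subseteq> carrier R" "p \<in> P" "g \<in> set gs"
  shows "p \<otimes> g \<in> lin_span R P W gs"
  using assms(3,5)
proof (induction gs)
  case (Cons g' gs)
  interpret P: ideal P R by fact
  interpret L: ideal "lin_span R P W gs" R using lin_span_ideal assms(1,2) Cons.prems by auto
  have gc: "g \<in> carrier R" "g' \<in> carrier R" using Cons.prems by auto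
  show ?case
  proof (cases "g = g'")
    case True
    have "p \<otimes> g = p \<otimes> g' \<oplus> \<zero>" using True P.Icarr[OF assms(4)] gc by simp
    then show ?thesis unfolding lin_span.simps using assms(4) L.zero_closed by blast
  next
    case False
    have "p \<otimes> g = \<zero> \<otimes> g' \<oplus> p \<otimes> g" using P.Icarr[OF assms(4)] gc by simp
    moreover have "p \<otimes> g \<in> lin_span R P W gs" using Cons False by simp
    ultimately show ?thesis unfolding lin_span.simps using P.zero_closed by blast
  qed
qed simp

lemma lin_span_mult_mem:
  assumes "ideal P R" "ideal W R" "set gs \<subseteq> carrier R" "b \<in> carrier R"
    and "\<And>g. g \<in> set gs \<Longrightarrow> b \<otimes> g \<in> W" "y \<in> lin_span R P W gs"
  shows "b \<otimes> y \<in> W"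
  using assms(3,5,6)
proof (induction gs arbitrary: y)
  case Nil
  then show ?case using ideal.I_l_closed[OF assms(2)] assms(4) by auto
next
  case (Cons g gs)
  interpret P: ideal P R by fact
  interpret W: ideal W R by fact
  interpret L: ideal "lin_span R P W gs" R using lin_span_ideal assms(1,2) Cons.prems by auto
  obtain p z where *: "p \<in> P" "z \<in> lin_span R P W gs" "y = p \<otimes> g \<oplus> z" using Cons.prems(3) by auto
  have "b \<otimes> y = p \<otimes> (b \<otimes> g) \<oplus> b \<otimes> z"
    unfolding *(3) using P.Icarr[OF *(1)] L.Icarr[OF *(2)] Cons.prems(1) assms(4)
    by (simp add: r_distr m_lcomm)
  moreover have "b \<otimes> g \<in> W" using Cons.prems(2) by simp
  moreover have "b \<otimes> z \<in> W" using Cons *(2) by auto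
  ultimately show ?case using P.Icarr[OF *(1)] W.I_l_closed by auto
qed

text \<open>The factor \<open>b\<^sub>0\<close> lets the generators be eliminated one at a time.\<close>

lemma lin_span_nakayama:
  assumes "ideal P R" "ideal W R" "set gs \<subseteq> carrier R" "b0 \<in> carrier R" "b0 \<ominus> \<one> \<in> P"
    and "\<And>g. g \<in> set gs \<Longrightarrow> b0 \<otimes> g \<in> lin_span R P W gs"
  shows "\<exists>b\<in>carrier R. b \<ominus> \<one> \<in> P \<and> (\<forall>g\<in>set gs. b \<otimes> g \<in> W)"
  using assms(3-6)
proof (induction gs arbitrary: b0)
  case Nil then show ?case by auto
next
  case (Cons g gs)
  interpret P: ideal P R by fact
  interpret W: ideal W R by fact
  have gs: "set gs \<subseteq> carrier R" and g: "g \<in> carrier R" using Cons.prems by auto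
  interpret L: ideal "lin_span R P W gs" R using lin_span_ideal assms(1,2) gs by auto
  note b0 = \<open>b0 \<in> carrier R\<close> \<open>b0 \<ominus> \<one> \<in> P\<close>
  have "b0 \<otimes> g \<in> lin_span R P W (g # gs)" using Cons.prems(4)[of g] by simp
  then obtain p y where p: "p \<in> P" "y \<in> lin_span R P W gs" "b0 \<otimes> g = p \<otimes> g \<oplus> y" by auto
  note pc = P.Icarr[OF p(1)] and yc = L.Icarr[OF p(2)]
  \<comment> \<open>Moving p g to the left-hand side makes \<open>b1 \<otimes> g = y\<close>, where
    \<open>g\<close> no longer occurs on the right, and \<open>b1\<close> is still 1 modulo
    \<open>P\<close>.\<close>
  define b1 where "b1 = b0 \<ominus> p"
  have b1: "b1 \<in> carrier R" unfolding b1_def using b0 pc by simp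
  have "b1 \<ominus> \<one> = (b0 \<ominus> \<one>) \<ominus> p" unfolding b1_def using b0 pc by algebra
  then have b1P: "b1 \<ominus> \<one> \<in> P" using b0 p(1) P.ideal_minus_closed by simp
  have "b1 \<otimes> g = b0 \<otimes> g \<ominus> p \<otimes> g" unfolding b1_def using b0 pc g by algebra
  also have "\<dots> = y" unfolding p(3) using pc g yc by algebra
  finally have b1g: "b1 \<otimes> g = y" .
  have "b1 \<otimes> b0 \<ominus> \<one> = b1 \<otimes> (b0 \<ominus> \<one>) \<oplus> (b1 \<ominus> \<one>)" using b0(1) b1 by algebra
  also have "\<dots> \<in> P" using b0 b1 b1P P.I_l_closed by auto
  finally have bb: "b1 \<otimes> b0 \<ominus> \<one> \<in> P" .
  \<comment> \<open>Multiplying the relation for g' by \<open>b1\<close> turns its term in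
    \<open>g\<close> into a multiple of \<open>y\<close>, so \<open>g\<close> is eliminated from all
    the remaining relations.\<close>
  have "(b1 \<otimes> b0) \<otimes> g' \<in> lin_span R P W gs" if "g' \<in> set gs" for g'
  proof -
    have g': "g' \<in> carrier R" using that gs by auto
    have "b0 \<otimes> g' \<in> lin_span R P W (g # gs)" using Cons.prems(4)[of g'] that by simp
    then obtain q z where q: "q \<in> P" "z \<in> lin_span R P W gs" "b0 \<otimes> g' = q \<otimes> g \<oplus> z" by auto
    have "(b1 \<otimes> b0) \<otimes> g' = b1 \<otimes> (b0 \<otimes> g')" using b0 b1 g' by (simp add: m_assoc)
    also have "\<dots> = q \<otimes> (b1 \<otimes> g) \<oplus> b1 \<otimes> z"
      unfolding q(3) using P.Icarr[OF q(1)] L.Icarr[OF q(2)] b1 g by (simp add: r_distr m_lcomm)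
    also have "\<dots> = q \<otimes> y \<oplus> b1 \<otimes> z" unfolding b1g ..
    also have "\<dots> \<in> lin_span R P W gs"
      using p(2) q P.Icarr b1 by (intro L.a_closed L.I_l_closed) auto
    finally show ?thesis .
  qed
  then obtain b where b: "b \<in> carrier R" "b \<ominus> \<one> \<in> P" "\<forall>g\<in>set gs. b \<otimes> g \<in> W"
    using Cons.IH[OF gs _ bb] b0(1) b1 by auto
  have "b \<otimes> b1 \<ominus> \<one> = b \<otimes> (b1 \<ominus> \<one>) \<oplus> (b \<ominus> \<one>)" using b(1) b1 by algebra
  also have "\<dots> \<in> P" using b b1P P.I_l_closed by auto
  finally have bb1: "b \<otimes> b1 \<ominus> \<one> \<in> P" .
  \<comment> \<open>The eliminated generator is recovered from \<open>b1 \<otimes> g = y\<close>, as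
    \<open>y\<close> lies in the span of the others and \<open>b\<close> carries that span into
    \<open>W\<close>.\<close>
  have bY: "b \<otimes> y \<in> W" using lin_span_mult_mem[OF assms(1,2) gs b(1) _ p(2)] b(3) by blast
  have "(b \<otimes> b1) \<otimes> g' \<in> W" if "g' \<in> set (g # gs)" for g'
  proof (cases "g' = g")
    case True
    then show ?thesis using bY b1g b(1) b1 g by (simp add: m_assoc)
  next
    case False
    then have "g' \<in> set gs" using that by simp
    then have "g' \<in> carrier R" "b \<otimes> g' \<in> W" using gs b(3) by auto
    moreover from this have "(b \<otimes> b1) \<otimes> g' = b1 \<otimes> (b \<otimes> g')" using b(1) b1 by (simp add: m_ac)
    ultimately show ?thesis using b1 W.I_l_closed by simp
  qed
  then show ?case using bb1 b(1) b1 by (intro bexI[of _ "b \<otimes> b1"]) auto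
qed

end

section \<open>Hilbert's basis theorem\<close>

text \<open>These are the values at \<open>x\<close> of the polynomials of degree less than n with
  coefficients in \<open>H\<close>. One element may have several such expressions, so a degree bound
  is tracked rather than a degree.\<close>

primrec polys_below :: "('a, 'b) ring_scheme \<Rightarrow> 'a set \<Rightarrow> 'a \<Rightarrow> nat \<Rightarrow> 'a set" where
  "polys_below R H x 0 = {\<zero>\<^bsub>R\<^esub>}"
| "polys_below R H x (Suc n) =
    {a \<otimes>\<^bsub>R\<^esub> x [^]\<^bsub>R\<^esub> n \<oplus>\<^bsub>R\<^esub> p | a p. a \<in> H \<and> p \<in> polys_below R H x n}"

context cring begin

context
  fixes H x
  assumes H: "subring H R" and x: "x \<in> carrier R"
begin

lemmas H_closed = subringE(2,3,5-7)[OF H]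

lemma H_carr: "a \<in> H \<Longrightarrow> a \<in> carrier R" using subringE(1)[OF H] by auto

lemma polys_below_carr: "p \<in> polys_below R H x n \<Longrightarrow> p \<in> carrier R"
  by (induction n arbitrary: p) (use x H_carr in auto)

lemma polys_belowI:
  "\<lbrakk>a \<in> H; p \<in> polys_below R H x n; q = a \<otimes> x [^] n \<oplus> p\<rbrakk> \<Longrightarrow> q \<in> polys_below R H x (Suc n)"
  by auto

lemma polys_below_add:
  "\<lbrakk>p \<in> polys_below R H x n; q \<in> polys_below R H x n\<rbrakk> \<Longrightarrow> p \<oplus> q \<in> polys_below R H x n"
proof (induction n arbitrary: p q)
  case (Suc n)
  then obtain a p' b q' where *: "a \<in> H" "p' \<in> polys_below R H x n" "p = a \<otimes> x [^] n \<oplus> p'"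
    "b \<in> H" "q' \<in> polys_below R H x n" "q = b \<otimes> x [^] n \<oplus> q'" by auto
  have c: "p' \<in> carrier R" "q' \<in> carrier R" "a \<in> carrier R" "b \<in> carrier R"
    using * polys_below_carr H_carr by blast+
  show ?case
    by (rule polys_belowI[of "a \<oplus> b" "p' \<oplus> q'"])
      (use * c x Suc.IH H_closed in \<open>auto simp: l_distr a_ac\<close>)
qed auto

lemma polys_below_smult:
  "\<lbrakk>c \<in> H; p \<in> polys_below R H x n\<rbrakk> \<Longrightarrow> c \<otimes> p \<in> polys_below R H x n"
proof (induction n arbitrary: p)
  case 0 then show ?case using H_carr by auto
next
  case (Suc n)
  then obtain a p' where *: "a \<in> H" "p' \<in> polys_below R H x n" "p = a \<otimes> x [^] n \<oplus> p'" by auto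
  have c: "p' \<in> carrier R" "a \<in> carrier R" "c \<in> carrier R"
    using * Suc.prems polys_below_carr H_carr by blast+
  show ?case
    by (rule polys_belowI[of "c \<otimes> a" "c \<otimes> p'"])
      (use * c x Suc H_closed in \<open>auto simp: r_distr m_assoc\<close>)
qed

lemma polys_below_minus:
  assumes "p \<in> polys_below R H x n" "q \<in> polys_below R H x n"
  shows "p \<ominus> q \<in> polys_below R H x n"
proof -
  have "p \<in> carrier R" "q \<in> carrier R" using assms polys_below_carr by blast+
  then have "p \<ominus> q = p \<oplus> (\<ominus> \<one>) \<otimes> q" by algebra
  moreover have "\<ominus> \<one> \<in> H" by (intro H_closed)
  ultimately show ?thesis using assms polys_below_add polys_below_smult by metis
qed

lemma polys_below_times_x:
  "p \<in> polys_below R H x n \<Longrightarrow> x \<otimes> p \<in> polys_below R H x (Suc n)"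
proof (induction n arbitrary: p)
  case 0 then show ?case using x polys_belowI[of \<zero> \<zero> 0 \<zero>] H_closed by simp
next
  case (Suc n)
  then obtain a p' where *: "a \<in> H" "p' \<in> polys_below R H x n" "p = a \<otimes> x [^] n \<oplus> p'" by auto
  have c: "p' \<in> carrier R" "a \<in> carrier R"
    using * polys_below_carr H_carr by blast+
  show ?case
    by (rule polys_belowI[of a "x \<otimes> p'"])
      (use * c x Suc.IH[OF *(2)] in \<open>auto simp: r_distr m_ac\<close>)
qed

lemma polys_below_Suc: "polys_below R H x n \<subseteq> polys_below R H x (Suc n)"
proof
  fix p assume p: "p \<in> polys_below R H x n"
  then show "p \<in> polys_below R H x (Suc n)"
    using polys_below_carr[OF p] x H_closed by (intro polys_belowI[of \<zero> p]) auto
qed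

lemma polys_below_mono: "m \<le> n \<Longrightarrow> polys_below R H x m \<subseteq> polys_below R H x n"
  using lift_Suc_mono_le[of "polys_below R H x", OF polys_below_Suc] .

lemma polys_below_times_pow:
  "p \<in> polys_below R H x n \<Longrightarrow> x [^] k \<otimes> p \<in> polys_below R H x (n + k)"
proof (induction k)
  case 0 then show ?case using polys_below_carr[OF 0] by simp
next
  case (Suc k)
  have "x [^] Suc k \<otimes> p = x \<otimes> (x [^] k \<otimes> p)" using polys_below_carr[OF Suc.prems] x by (simp add: m_ac)
  then show ?case using polys_below_times_x[OF Suc.IH[OF Suc.prems]] by simp
qed

text \<open>The bound exceeds the sharp one by 1, which keeps subtraction out of the
  induction.\<close>

lemma polys_below_mult:
  "\<lbrakk>p \<in> polys_below R H x n; q \<in> polys_below R H x m\<rbrakk> \<Longrightarrow> p \<otimes> q \<in> polys_below R H x (m + n)"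
proof (induction n arbitrary: p)
  case 0
  then have "p \<otimes> q = \<zero>" using polys_below_carr[of q] by simp
  then show ?case using polys_below_mono[of 0 "m + 0"] by auto
next
  case (Suc n)
  then obtain a p' where *: "a \<in> H" "p' \<in> polys_below R H x n" "p = a \<otimes> x [^] n \<oplus> p'" by auto
  have c: "p' \<in> carrier R" "a \<in> carrier R" "q \<in> carrier R"
    using * Suc.prems polys_below_carr H_carr by blast+
  have "p \<otimes> q = a \<otimes> (x [^] n \<otimes> q) \<oplus> p' \<otimes> q" unfolding *(3) using c x by (simp add: l_distr m_assoc)
  moreover have "a \<otimes> (x [^] n \<otimes> q) \<in> polys_below R H x (m + n)"
    by (intro polys_below_smult polys_below_times_pow * Suc.prems)
  moreover have "p' \<otimes> q \<in> polys_below R H x (m + n)" by (intro Suc.IH * Suc.prems)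
  ultimately have "p \<otimes> q \<in> polys_below R H x (m + n)" using polys_below_add by simp
  then show ?case using polys_below_Suc[of "m + n"] by auto
qed

lemma polys_below_const: "a \<in> H \<Longrightarrow> a \<in> polys_below R H x (Suc 0)"
  using polys_belowI[of a \<zero> 0] H_carr by simp

lemma polys_below_var: "x \<in> polys_below R H x (Suc (Suc 0))"
  using polys_below_times_x[OF polys_below_const[of \<one>]] x H_closed by simp

lemma polys_subring: "subring (\<Union>n. polys_below R H x n) R"
proof (rule subringI)
  show "(\<Union>n. polys_below R H x n) \<subseteq> carrier R" using polys_below_carr by blast
  show "\<one> \<in> (\<Union>n. polys_below R H x n)" using polys_below_const[of \<one>] H_closed by blast
next
  fix p assume "p \<in> (\<Union>n. polys_below R H x n)"
  then obtain n where n: "p \<in> polys_below R H x n" by blast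
  have "\<ominus> \<one> \<otimes> p = \<ominus> p" using polys_below_carr[OF n] by (simp add: l_minus)
  moreover have "\<ominus> \<one> \<in> H" by (intro H_closed)
  ultimately show "\<ominus> p \<in> (\<Union>n. polys_below R H x n)" using polys_below_smult n by (metis UN_I UNIV_I)
next
  fix p q assume "p \<in> (\<Union>n. polys_below R H x n)" "q \<in> (\<Union>n. polys_below R H x n)"
  then obtain n m where nm: "p \<in> polys_below R H x n" "q \<in> polys_below R H x m" by blast
  then show "p \<otimes> q \<in> (\<Union>n. polys_below R H x n)" using polys_below_mult by blast
  have "p \<in> polys_below R H x (max n m)" "q \<in> polys_below R H x (max n m)"
    using nm polys_below_mono[of n "max n m"] polys_below_mono[of m "max n m"] by auto
  then show "p \<oplus> q \<in> (\<Union>n. polys_below R H x n)" using polys_below_add by blast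
qed

end

end

text \<open>Hilbert's argument with leading coefficients works for any ring generated by an image of
  \<open>A\<close> and one element \<open>x\<close>. This covers rings of polynomial functions,
  where different polynomials may define the same function.\<close>

lemma hilbert_basis:
  assumes A: "cring A" "noetherian_ring A" and B: "cring B" and h: "h \<in> ring_hom A B"
    and x: "x \<in> carrier B"
    and gen: "carrier B \<subseteq> (\<Union>n. polys_below B (h ` carrier A) x n)"
  shows "noetherian_ring B"
proof -
  interpret A: cring A by (rule A)
  interpret A: noetherian_cring A using A by (simp add: noetherian_cring_def)
  interpret B: cring B by (rule B)
  interpret h: ring_hom_cring A B h by unfold_locales (rule h)
  let ?H = "h ` carrier A" and ?P = "polys_below B (h ` carrier A) x"
  have H: "subring ?H B" by (rule h.ring.img_is_subring[OF A.carrier_is_subring])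
  note Pc = B.polys_below_carr[OF H x]
  \<comment> \<open>The possible coefficients of x^n in expressions of elements of \<open>K\<close>
    of degree at most n. Zero is always among them, and multiplication by \<open>x\<close> makes
    these ideals ascend in n.\<close>
  define lead where "lead K n = {a \<in> carrier A. \<exists>p\<in>?P n. h a \<otimes>\<^bsub>B\<^esub> x [^]\<^bsub>B\<^esub> n \<oplus>\<^bsub>B\<^esub> p \<in> K}" for K and n :: nat
  have leadI: "a \<in> lead K n"
    if "a \<in> carrier A" "p \<in> ?P n" "q = h a \<otimes>\<^bsub>B\<^esub> x [^]\<^bsub>B\<^esub> n \<oplus>\<^bsub>B\<^esub> p" "q \<in> K" for a p q K n
    using that unfolding lead_def by auto
  have leadE: "\<exists>p\<in>?P n. h a \<otimes>\<^bsub>B\<^esub> x [^]\<^bsub>B\<^esub> n \<oplus>\<^bsub>B\<^esub> p \<in> K" "a \<in> carrier A" if "a \<in> lead K n" for a K n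
    using that unfolding lead_def by auto
  have xn: "x [^]\<^bsub>B\<^esub> n \<in> carrier B" for n :: nat using x by simp
  have lead_ideal: "ideal (lead K n) A" if K: "ideal K B" for K n
  proof (rule A.cring_idealI)
    interpret K: ideal K B by (rule K)
    show "lead K n \<subseteq> carrier A" unfolding lead_def by blast
    have "\<zero>\<^bsub>B\<^esub> \<in> ?P n" using B.polys_below_mono[OF H x, of 0 n] by auto
    then show "\<zero>\<^bsub>A\<^esub> \<in> lead K n" by (intro leadI[OF _ _ refl]) (use xn in auto)
    fix a assume a: "a \<in> lead K n"
    then obtain p where p: "p \<in> ?P n" "h a \<otimes>\<^bsub>B\<^esub> x [^]\<^bsub>B\<^esub> n \<oplus>\<^bsub>B\<^esub> p \<in> K" using leadE by blast
    note ac = leadE(2)[OF a]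
    {
      fix b assume b: "b \<in> lead K n"
      then obtain q where q: "q \<in> ?P n" "h b \<otimes>\<^bsub>B\<^esub> x [^]\<^bsub>B\<^esub> n \<oplus>\<^bsub>B\<^esub> q \<in> K" using leadE by blast
      have "h (a \<oplus>\<^bsub>A\<^esub> b) \<otimes>\<^bsub>B\<^esub> x [^]\<^bsub>B\<^esub> n \<oplus>\<^bsub>B\<^esub> (p \<oplus>\<^bsub>B\<^esub> q)
          = (h a \<otimes>\<^bsub>B\<^esub> x [^]\<^bsub>B\<^esub> n \<oplus>\<^bsub>B\<^esub> p) \<oplus>\<^bsub>B\<^esub> (h b \<otimes>\<^bsub>B\<^esub> x [^]\<^bsub>B\<^esub> n \<oplus>\<^bsub>B\<^esub> q)"
        using ac leadE(2)[OF b] Pc[OF p(1)] Pc[OF q(1)] xn by (simp add: B.l_distr B.a_ac)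
      then show "a \<oplus>\<^bsub>A\<^esub> b \<in> lead K n"
        using ac leadE(2)[OF b] p q B.polys_below_add[OF H x]
        by (intro leadI[OF _ _ refl, of _ "p \<oplus>\<^bsub>B\<^esub> q"]) auto
    next
      fix r assume r: "r \<in> carrier A"
      have "h (r \<otimes>\<^bsub>A\<^esub> a) \<otimes>\<^bsub>B\<^esub> x [^]\<^bsub>B\<^esub> n \<oplus>\<^bsub>B\<^esub> (h r \<otimes>\<^bsub>B\<^esub> p)
          = h r \<otimes>\<^bsub>B\<^esub> (h a \<otimes>\<^bsub>B\<^esub> x [^]\<^bsub>B\<^esub> n \<oplus>\<^bsub>B\<^esub> p)"
        using ac r Pc[OF p(1)] xn by (simp add: B.r_distr B.m_assoc)
      then show "r \<otimes>\<^bsub>A\<^esub> a \<in> lead K n"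
        using ac r p B.polys_below_smult[OF H x] K.I_l_closed
        by (intro leadI[OF _ _ refl, of _ "h r \<otimes>\<^bsub>B\<^esub> p"]) auto
    }
  qed
  have lead_Suc: "lead K n \<subseteq> lead K (Suc n)" if K: "ideal K B" for K n
  proof
    interpret K: ideal K B by (rule K)
    fix a assume a: "a \<in> lead K n"
    then obtain p where p: "p \<in> ?P n" "h a \<otimes>\<^bsub>B\<^esub> x [^]\<^bsub>B\<^esub> n \<oplus>\<^bsub>B\<^esub> p \<in> K" using leadE by blast
    note ac = leadE(2)[OF a]
    have "h a \<otimes>\<^bsub>B\<^esub> x [^]\<^bsub>B\<^esub> Suc n \<oplus>\<^bsub>B\<^esub> (x \<otimes>\<^bsub>B\<^esub> p) = x \<otimes>\<^bsub>B\<^esub> (h a \<otimes>\<^bsub>B\<^esub> x [^]\<^bsub>B\<^esub> n \<oplus>\<^bsub>B\<^esub> p)"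
      using ac Pc[OF p(1)] xn x by (simp add: B.r_distr B.m_ac)
    then show "a \<in> lead K (Suc n)"
      using ac p(2) B.polys_below_times_x[OF H x p(1)] K.I_l_closed x
      by (intro leadI[OF _ _ refl, of _ "x \<otimes>\<^bsub>B\<^esub> p"]) auto
  qed
  have lead_mono: "m \<le> n \<Longrightarrow> lead K m \<subseteq> lead K n" if K: "ideal K B" for K m n
    using lift_Suc_mono_le[of "lead K"] lead_Suc[OF K] by blast
  \<comment> \<open>An ideal contained in \<open>K\<close> with at least the same leading
    coefficients is all of \<open>K\<close>: subtracting from an element of \<open>K\<close> one of
    \<open>K'\<close> with the same top term leaves an element of \<open>K\<close> with a smaller
    degree bound.\<close>
  have sub: "K \<subseteq> K'" if K: "ideal K B" "ideal K' B" "K' \<subseteq> K" "\<And>n. lead K n \<subseteq> lead K' n" for K K'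
  proof -
    interpret K: ideal K B by (rule K)
    interpret K': ideal K' B by (rule K)
    have "K \<inter> ?P n \<subseteq> K'" for n
    proof (induction n)
      case (Suc n)
      show ?case
      proof
        fix k assume k: "k \<in> K \<inter> ?P (Suc n)"
        then obtain a p where p: "a \<in> carrier A" "p \<in> ?P n" "k = h a \<otimes>\<^bsub>B\<^esub> x [^]\<^bsub>B\<^esub> n \<oplus>\<^bsub>B\<^esub> p" by auto
        then have "a \<in> lead K' n" using k K(4) leadI by blast
        then obtain q where q: "q \<in> ?P n" "h a \<otimes>\<^bsub>B\<^esub> x [^]\<^bsub>B\<^esub> n \<oplus>\<^bsub>B\<^esub> q \<in> K'" using leadE by blast
        let ?k = "h a \<otimes>\<^bsub>B\<^esub> x [^]\<^bsub>B\<^esub> n \<oplus>\<^bsub>B\<^esub> q"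
        have hc: "h a \<otimes>\<^bsub>B\<^esub> x [^]\<^bsub>B\<^esub> n \<in> carrier B" using p(1) xn by simp
        have "p \<ominus>\<^bsub>B\<^esub> q = k \<ominus>\<^bsub>B\<^esub> ?k"
          unfolding p(3) using hc Pc[OF p(2)] Pc[OF q(1)]
          by (simp add: B.minus_eq B.minus_add B.a_ac B.r_neg B.r_neg2 B.r_neg1)
        moreover have "k \<ominus>\<^bsub>B\<^esub> ?k \<in> K" using k q K(3) by (intro K.ideal_minus_closed) auto
        moreover have "p \<ominus>\<^bsub>B\<^esub> q \<in> ?P n" using p q B.polys_below_minus[OF H x] by blast
        ultimately have "p \<ominus>\<^bsub>B\<^esub> q \<in> K'" using Suc.IH by auto
        moreover have "k = ?k \<oplus>\<^bsub>B\<^esub> (p \<ominus>\<^bsub>B\<^esub> q)"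
          unfolding p(3) using hc Pc[OF p(2)] Pc[OF q(1)]
          by (simp add: B.minus_eq B.a_ac B.r_neg B.r_neg2 B.r_neg1)
        ultimately show "k \<in> K'" using q(2) by auto
      qed
    qed auto
    then show ?thesis using gen K.Icarr by blast
  qed
  show ?thesis
  proof (rule B.noetherian_ringI)
    fix K assume K: "ideal K B"
    interpret K: ideal K B by (rule K)
    obtain N where N: "\<And>n. n \<ge> N \<Longrightarrow> lead K n = lead K N"
      using A.ascending_ideals_stable[of "lead K"] lead_ideal[OF K] lead_Suc[OF K] by blast
    have "\<exists>S\<subseteq>carrier A. finite S \<and> lead K n = Idl\<^bsub>A\<^esub> S" for n
      using A.finetely_gen[OF lead_ideal[OF K]] by blast
    then obtain S where S: "\<And>n. S n \<subseteq> carrier A" "\<And>n. finite (S n)" "\<And>n. lead K n = Idl\<^bsub>A\<^esub> (S n)"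
      by metis
    have "\<forall>n. \<forall>a\<in>S n. \<exists>p\<in>?P n. h a \<otimes>\<^bsub>B\<^esub> x [^]\<^bsub>B\<^esub> n \<oplus>\<^bsub>B\<^esub> p \<in> K"
      using S A.genideal_self leadE(1) by (metis subsetD)
    then obtain w where w: "\<And>n a. a \<in> S n \<Longrightarrow> w n a \<in> ?P n"
        "\<And>n a. a \<in> S n \<Longrightarrow> h a \<otimes>\<^bsub>B\<^esub> x [^]\<^bsub>B\<^esub> n \<oplus>\<^bsub>B\<^esub> w n a \<in> K"
      by metis
    \<comment> \<open>For each n up to the stationary index \<open>N\<close>, generators of the
      ideal of leading coefficients are lifted to elements of \<open>K\<close>. For larger n the
      leading coefficients are those at \<open>N\<close>.\<close>
    define G where "G = (\<Union>n\<le>N. (\<lambda>a. h a \<otimes>\<^bsub>B\<^esub> x [^]\<^bsub>B\<^esub> n \<oplus>\<^bsub>B\<^esub> w n a) ` S n)"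
    have G: "finite G" "G \<subseteq> K" unfolding G_def using S(2) w(2) by auto
    then have Gc: "G \<subseteq> carrier B" using K.Icarr by blast
    have idG: "ideal (Idl\<^bsub>B\<^esub> G) B" by (rule B.genideal_ideal[OF Gc])
    have GK: "Idl\<^bsub>B\<^esub> G \<subseteq> K" by (rule B.genideal_minimal[OF K G(2)])
    have le: "lead K n \<subseteq> lead (Idl\<^bsub>B\<^esub> G) n" if "n \<le> N" for n
    proof -
      have "a \<in> lead (Idl\<^bsub>B\<^esub> G) n" if a: "a \<in> S n" for a
      proof (rule leadI)
        show "a \<in> carrier A" using a S by blast
        show "w n a \<in> ?P n" using w a by blast
        have "h a \<otimes>\<^bsub>B\<^esub> x [^]\<^bsub>B\<^esub> n \<oplus>\<^bsub>B\<^esub> w n a \<in> G" unfolding G_def using a \<open>n \<le> N\<close> by auto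
        then show "h a \<otimes>\<^bsub>B\<^esub> x [^]\<^bsub>B\<^esub> n \<oplus>\<^bsub>B\<^esub> w n a \<in> Idl\<^bsub>B\<^esub> G"
          using B.genideal_self[OF Gc] by blast
      qed (rule refl)
      then show ?thesis unfolding S(3) by (intro A.genideal_minimal lead_ideal idG) blast
    qed
    have "lead K n \<subseteq> lead (Idl\<^bsub>B\<^esub> G) n" for n
    proof (cases "n \<le> N")
      case True then show ?thesis by (rule le)
    next
      case False
      then show ?thesis using N[of n] le[of N] lead_mono[OF idG, of N n] by auto
    qed
    then have "K \<subseteq> Idl\<^bsub>B\<^esub> G" by (rule sub[OF K idG GK])
    then show "\<exists>A\<subseteq>carrier B. finite A \<and> K = Idl\<^bsub>B\<^esub> A" using GK G(1) Gc by blast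
  qed
qed

section \<open>A uniform bound for reductions\<close>

lemma (in cring) add_minus_cancel_left:
  "\<lbrakk>x \<in> carrier R; y \<in> carrier R\<rbrakk> \<Longrightarrow> (x \<oplus> y) \<ominus> x = y"
  by algebra

lemma (in ring_hom_ring) hom_minus:
  "\<lbrakk>x \<in> carrier R; y \<in> carrier R\<rbrakk> \<Longrightarrow> h (x \<ominus>\<^bsub>R\<^esub> y) = h x \<ominus>\<^bsub>S\<^esub> h y"
  by (simp add: a_minus_def)

section \<open>Rings of polynomial functions\<close>

text \<open>Functions take the place of formal polynomials, so that specializing the indeterminates
  is evaluation at a point.\<close>

definition fun_ring :: "('a, 'b) ring_scheme \<Rightarrow> ('x \<Rightarrow> 'a) ring"
  where "fun_ring R =
    \<lparr>carrier = {f. \<forall>c. f c \<in> carrier R}, mult = (\<lambda>f g c. f c \<otimes>\<^bsub>R\<^esub> g c), one = (\<lambda>c. \<one>\<^bsub>R\<^esub>),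
     zero = (\<lambda>c. \<zero>\<^bsub>R\<^esub>), add = (\<lambda>f g c. f c \<oplus>\<^bsub>R\<^esub> g c)\<rparr>"

lemma fun_ring_simps [simp]:
  "f \<in> carrier (fun_ring R) \<longleftrightarrow> (\<forall>c. f c \<in> carrier R)"
  "f \<otimes>\<^bsub>fun_ring R\<^esub> g = (\<lambda>c. f c \<otimes>\<^bsub>R\<^esub> g c)"
  "f \<oplus>\<^bsub>fun_ring R\<^esub> g = (\<lambda>c. f c \<oplus>\<^bsub>R\<^esub> g c)"
  "\<one>\<^bsub>fun_ring R\<^esub> = (\<lambda>c. \<one>\<^bsub>R\<^esub>)"
  "\<zero>\<^bsub>fun_ring R\<^esub> = (\<lambda>c. \<zero>\<^bsub>R\<^esub>)"
  by (simp_all add: fun_ring_def)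

lemma (in cring) fun_ring_cring: "cring (fun_ring R :: ('x \<Rightarrow> 'a) ring)"
proof (rule cringI)
  show "abelian_group (fun_ring R :: ('x \<Rightarrow> 'a) ring)"
  proof (rule abelian_groupI)
    fix f :: "'x \<Rightarrow> 'a" assume "f \<in> carrier (fun_ring R)"
    then show "\<exists>g\<in>carrier (fun_ring R). g \<oplus>\<^bsub>fun_ring R\<^esub> f = \<zero>\<^bsub>fun_ring R\<^esub>"
      by (intro bexI[of _ "\<lambda>c. \<ominus> f c"]) (auto simp: l_neg)
  qed (auto simp: a_ac)
  show "comm_monoid (fun_ring R :: ('x \<Rightarrow> 'a) ring)"
    by (rule comm_monoidI) (auto simp: m_ac)
qed (auto simp: l_distr)

text \<open>The coordinate functions are made total by the junk value \<open>\<zero>\<close> outside \<open>carrier R\<close>.\<close>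

definition coord :: "('a, 'b) ring_scheme \<Rightarrow> 'v \<Rightarrow> ('v \<Rightarrow> 'a) \<Rightarrow> 'a"
  where "coord R v c = (if c v \<in> carrier R then c v else \<zero>\<^bsub>R\<^esub>)"

text \<open>This is the subring generated by the constants and the coordinate functions of the
  listed variables. Adjoining one variable at a time matches the form of
  \<open>hilbert_basis\<close>.\<close>

primrec poly_funs :: "('a, 'b) ring_scheme \<Rightarrow> 'v list \<Rightarrow> (('v \<Rightarrow> 'a) \<Rightarrow> 'a) set" where
  "poly_funs R [] = (\<lambda>a c. a) ` carrier R"
| "poly_funs R (v # vs) = (\<Union>n. polys_below (fun_ring R) (poly_funs R vs) (coord R v) n)"

abbreviation poly_fun_ring :: "('a, 'b) ring_scheme \<Rightarrow> 'v list \<Rightarrow> (('v \<Rightarrow> 'a) \<Rightarrow> 'a) ring"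
  where "poly_fun_ring R vs \<equiv> (fun_ring R)\<lparr>carrier := poly_funs R vs\<rparr>"

text \<open>Polynomials are formed in the ring of all functions, whereas
  \<open>hilbert_basis\<close> is applied inside a subring; the arithmetic is the same.\<close>

lemma polys_below_update_carrier:
  assumes "monoid R"
  shows "polys_below (R\<lparr>carrier := C\<rparr>) H x n = polys_below R H x n"
  by (induction n) (simp_all add: monoid.nat_pow_consistent[OF assms, symmetric])

context cring begin

lemma coord_closed [simp]: "coord R v c \<in> carrier R"
  by (simp add: coord_def)

lemma coord_in_fun_ring: "coord R v \<in> carrier (fun_ring R)"
  by simp

lemma poly_funs_subring: "subring (poly_funs R (vs :: 'v list)) (fun_ring R)"
proof (induction vs)
  case Nil
  interpret F: cring "fun_ring R :: (('v \<Rightarrow> 'a) \<Rightarrow> 'a) ring" by (rule fun_ring_cring)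
  interpret h: ring_hom_cring R "fun_ring R :: (('v \<Rightarrow> 'a) \<Rightarrow> 'a) ring" "\<lambda>a c. a"
    by unfold_locales (auto intro!: ring_hom_memI)
  show ?case using h.ring.img_is_subring[OF carrier_is_subring] by simp
next
  case (Cons v vs)
  show ?case using cring.polys_subring[OF fun_ring_cring Cons, of "coord R v"] by simp
qed

lemma poly_funs_Cons: "poly_funs R vs \<subseteq> poly_funs R (v # vs)"
proof
  fix f assume "f \<in> poly_funs R vs"
  then have "f \<in> polys_below (fun_ring R) (poly_funs R vs) (coord R v) (Suc 0)"
    by (rule cring.polys_below_const[OF fun_ring_cring poly_funs_subring coord_in_fun_ring])
  then show "f \<in> poly_funs R (v # vs)" unfolding poly_funs.simps by (rule UN_I[OF UNIV_I])
qed

lemma const_in_poly_funs: "a \<in> carrier R \<Longrightarrow> (\<lambda>c. a) \<in> poly_funs R vs"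
proof (induction vs)
  case (Cons v vs)
  then have "(\<lambda>c. a) \<in> poly_funs R vs" by blast
  then show ?case by (rule subsetD[OF poly_funs_Cons])
qed simp

lemma coord_in_poly_funs: "v \<in> set vs \<Longrightarrow> coord R v \<in> poly_funs R vs"
proof (induction vs)
  case (Cons v' vs)
  show ?case
  proof (cases "v = v'")
    case True
    have "coord R v \<in> polys_below (fun_ring R) (poly_funs R vs) (coord R v) (Suc (Suc 0))"
      by (rule cring.polys_below_var[OF fun_ring_cring poly_funs_subring coord_in_fun_ring])
    then show ?thesis unfolding poly_funs.simps True by (rule UN_I[OF UNIV_I])
  next
    case False
    then have "coord R v \<in> poly_funs R vs" using Cons by simp
    then show ?thesis by (rule subsetD[OF poly_funs_Cons])
  qed
qed simp

lemma poly_funs_carr: "f \<in> poly_funs R vs \<Longrightarrow> f c \<in> carrier R"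
  using subringE(1)[OF poly_funs_subring, of vs] by auto

lemma poly_fun_ring_cring: "cring (poly_fun_ring R vs)"
  using ring.subcring_iff[OF cring.axioms(1)[OF fun_ring_cring] subringE(1)[OF poly_funs_subring]]
    cring.subcringI'[OF fun_ring_cring poly_funs_subring] by blast

lemma const_hom: "ring_hom_ring R (poly_fun_ring R vs) (\<lambda>a c. a)"
  by (rule ring_hom_ringI2[OF ring_axioms cring.axioms(1)[OF poly_fun_ring_cring]], rule ring_hom_memI)
    (simp_all add: const_in_poly_funs)

lemma eval_hom: "ring_hom_ring (poly_fun_ring R vs) R (\<lambda>b. b c)"
  by (rule ring_hom_ringI2[OF cring.axioms(1)[OF poly_fun_ring_cring] ring_axioms], rule ring_hom_memI)
    (simp_all add: poly_funs_carr)

lemma poly_fun_ring_minus: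
  assumes "f \<in> carrier (poly_fun_ring R vs)" "g \<in> carrier (poly_fun_ring R vs)"
  shows "(f \<ominus>\<^bsub>poly_fun_ring R vs\<^esub> g) c = f c \<ominus> g c"
  by (rule ring_hom_ring.hom_minus[OF eval_hom assms])

end

lemma (in noetherian_cring) poly_fun_ring_noetherian: "noetherian_ring (poly_fun_ring R vs)"
proof (induction vs)
  case Nil
  have c: "cring (poly_fun_ring R ([] :: 'v list))" by (rule poly_fun_ring_cring)
  have h: "(\<lambda>a c. a) \<in> ring_hom R (poly_fun_ring R ([] :: 'v list))"
    by (auto intro!: ring_hom_memI)
  show ?case
  \<comment> \<open>The ring of constants is an image of \<open>R\<close>; adjoining the element 0
    makes \<open>hilbert_basis\<close> applicable to it.\<close>
  proof (rule hilbert_basis[OF is_cring noetherian_ring_axioms c h])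
    let ?B = "poly_fun_ring R ([] :: 'v list)"
    show "\<zero>\<^bsub>?B\<^esub> \<in> carrier ?B" by simp
    have *: "f \<in> polys_below ?B ((\<lambda>a c. a) ` carrier R) \<zero>\<^bsub>?B\<^esub> (Suc 0)"
      if f: "f \<in> (\<lambda>a c. a) ` carrier R" for f :: "('v \<Rightarrow> 'a) \<Rightarrow> 'a"
    proof -
      have "f c \<in> carrier R" for c using f by auto
      then have "f = f \<otimes>\<^bsub>?B\<^esub> \<zero>\<^bsub>?B\<^esub> [^]\<^bsub>?B\<^esub> (0 :: nat) \<oplus>\<^bsub>?B\<^esub> \<zero>\<^bsub>?B\<^esub>"
        by (simp add: fun_eq_iff)
      then show ?thesis unfolding polys_below.simps using f by blast
    qed
    show "carrier ?B \<subseteq> (\<Union>n. polys_below ?B ((\<lambda>a c. a) ` carrier R) \<zero>\<^bsub>?B\<^esub> n)"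
    proof
      fix f :: "('v \<Rightarrow> 'a) \<Rightarrow> 'a" assume "f \<in> carrier ?B"
      then have "f \<in> (\<lambda>a c. a) ` carrier R" by simp
      then have "f \<in> polys_below ?B ((\<lambda>a c. a) ` carrier R) \<zero>\<^bsub>?B\<^esub> (Suc 0)" by (rule *)
      then show "f \<in> (\<Union>n. polys_below ?B ((\<lambda>a c. a) ` carrier R) \<zero>\<^bsub>?B\<^esub> n)"
        by (rule UN_I[OF UNIV_I])
    qed
  qed
next
  case (Cons v vs)
  have h: "(\<lambda>f. f) \<in> ring_hom (poly_fun_ring R vs) (poly_fun_ring R (v # vs))"
    by (rule ring_hom_memI) (simp_all add: subsetD[OF poly_funs_Cons] del: poly_funs.simps)
  show ?case
  proof (rule hilbert_basis[OF poly_fun_ring_cring Cons poly_fun_ring_cring h])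
    show "coord R v \<in> carrier (poly_fun_ring R (v # vs))"
      using coord_in_poly_funs[of v "v # vs"] by (simp del: poly_funs.simps)
    show "carrier (poly_fun_ring R (v # vs))
        \<subseteq> (\<Union>n. polys_below (poly_fun_ring R (v # vs)) ((\<lambda>f. f) ` carrier (poly_fun_ring R vs)) (coord R v) n)"
      using polys_below_update_carrier[OF ring.is_monoid[OF cring.axioms(1)[OF fun_ring_cring]],
          where C = "poly_funs R (v # vs)"] by simp
  qed
qed

text \<open>This supplies the coefficients at which generic elements are specialized to given
  ones.\<close>

lemma (in cring) genideal_finite_finsum:
  assumes "finite F" "F \<subseteq> carrier R" "x \<in> Idl F"
  shows "\<exists>c. (\<forall>f. c f \<in> carrier R) \<and> x = (\<Oplus>f\<in>F. c f \<otimes> f)"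
  using assms
proof (induction F arbitrary: x)
  case empty
  have "Idl {} \<subseteq> {\<zero>}" by (intro genideal_minimal zeroideal) simp
  then show ?case using empty by (intro exI[of _ "\<lambda>_. \<zero>"]) auto
next
  case (insert f F)
  have c: "F \<subseteq> carrier R" "f \<in> carrier R" using insert by auto
  obtain J where J: "ideal J R" "Idl F \<subseteq> J" "f \<in> J"
    "\<And>x. x \<in> J \<Longrightarrow> \<exists>p\<in>Idl F. \<exists>r\<in>carrier R. x = p \<oplus> r \<otimes> f"
    using ideal_insert[OF genideal_ideal[OF c(1)] c(2)] by blast
  have "insert f F \<subseteq> J" using J(2,3) genideal_self[OF c(1)] by blast
  then have "x \<in> J" using genideal_minimal[OF J(1)] insert.prems by blast
  then obtain p r where p: "p \<in> Idl F" "r \<in> carrier R" "x = p \<oplus> r \<otimes> f" using J(4) by blast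
  obtain c' where c': "\<And>f. c' f \<in> carrier R" "p = (\<Oplus>f\<in>F. c' f \<otimes> f)"
    using insert.IH[OF c(1) p(1)] by blast
  let ?c = "c'(f := r)"
  have "(\<Oplus>g\<in>F. ?c g \<otimes> g) = (\<Oplus>g\<in>F. c' g \<otimes> g)"
    using c c' insert.hyps by (intro finsum_cong') (auto simp: subset_iff)
  moreover have "(\<Oplus>g\<in>insert f F. ?c g \<otimes> g) = ?c f \<otimes> f \<oplus> (\<Oplus>g\<in>F. ?c g \<otimes> g)"
    using c c'(1) p(2) insert.hyps by (intro finsum_insert) (auto simp: subset_iff)
  moreover have "p \<in> carrier R" using p(1) ideal.Icarr[OF genideal_ideal[OF c(1)]] by blast
  ultimately have "x = (\<Oplus>g\<in>insert f F. ?c g \<otimes> g)"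
    using p c'(2) c(2) by (simp add: a_comm)
  then show ?case using c'(1) p(2) by (intro exI[of _ ?c]) auto
qed

text \<open>The summand \<open>I\<^sup>r\<^sup>+\<^sup>2\<close> is there because only modulo \<open>I\<^sup>2\<close> can a reduction be replaced by
  boundedly many of its elements.\<close>

definition reduction_gens :: "('a, 'b) ring_scheme \<Rightarrow> 'a set \<Rightarrow> nat \<Rightarrow> (nat \<Rightarrow> 'a) \<Rightarrow> nat \<Rightarrow> 'a set"
  where "reduction_gens R I g h r =
    {h i \<otimes>\<^bsub>R\<^esub> z | i z. i < g \<and> z \<in> ideal_pow R I r} \<union> ideal_pow R I (Suc (Suc r))"

lemma (in cring) reduction_gens_carr:
  assumes "ideal I R" "\<And>i. i < g \<Longrightarrow> h i \<in> carrier R"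
  shows "reduction_gens R I g h r \<subseteq> carrier R"
  unfolding reduction_gens_def using assms(2) ideal.Icarr[OF ideal_pow_ideal[OF assms(1)]] m_closed
  by blast

text \<open>The point is that \<open>N\<close> is chosen before \<open>h\<close> and
  \<open>r\<close>. Every \<open>h\<close> is a specialization of the same generic elements, and
  \<open>N\<close> is the index at which an ascending chain of ideals over their coefficient ring
  becomes stationary.\<close>

lemma (in noetherian_cring) uniform_reduction_number:
  assumes I: "ideal I R"
  obtains N where "\<And>h r k. \<lbrakk>h ` {..<g} \<subseteq> I; ideal_pow R I (Suc r) \<subseteq> Idl (reduction_gens R I g h r); N \<le> k\<rbrakk>
    \<Longrightarrow> ideal_pow R I (Suc k) \<subseteq> Idl (reduction_gens R I g h k)"
proof -
  interpret I: ideal I R by (rule I)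
  let ?P = "ideal_pow R I"
  have P: "ideal (?P n) R" for n by (rule ideal_pow_ideal[OF I])
  have Pc: "z \<in> carrier R" if "z \<in> ?P n" for z n using ideal.Icarr[OF P that] .
  obtain F where F: "F \<subseteq> carrier R" "finite F" "I = Idl F" using finetely_gen[OF I] by blast
  have FI: "F \<subseteq> I" using F genideal_self by blast

  \<comment> \<open>Generic elements and their colon ideals\<close>
  \<comment> \<open>There is one indeterminate for each of the \<open>g\<close> elements and each
    generator of \<open>I\<close>.\<close>
  obtain vs :: "(nat \<times> 'a) list" where vs: "set vs = {..<g} \<times> F"
    using finite_list[of "{..<g} \<times> F"] F(2) by auto
  let ?B = "poly_fun_ring R vs"
  interpret B: cring ?B by (rule poly_fun_ring_cring)
  interpret B: noetherian_cring ?B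
    using poly_fun_ring_noetherian B.is_cring by (simp add: noetherian_cring_def)
  let ?c = "\<lambda>a (_ :: nat \<times> 'a \<Rightarrow> 'a). a"
  have cB: "?c a \<in> carrier ?B" if "a \<in> carrier R" for a using const_in_poly_funs[OF that] by simp
  note const_vimage = ring_hom_ring.ideal_vimage[OF const_hom[of vs]]
  note eval_vimage = ring_hom_ring.ideal_vimage[OF eval_hom[of vs]]
  define V where "V i = (\<lambda>c. \<Oplus>f\<in>F. coord R (i, f) c \<otimes> f)" for i :: nat
  have part: "(\<lambda>c. \<Oplus>f\<in>F'. coord R (i, f) c \<otimes> f) \<in> carrier ?B" if "i < g" "F' \<subseteq> F" for i F'
    using finite_subset[OF that(2) F(2)] that(2)
  proof (induction F')
    case empty
    then show ?case using cB[of \<zero>] by simp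
  next
    case (insert f F')
    have fc: "f \<in> carrier R" "F' \<subseteq> carrier R" and fF: "f \<in> F" using insert F(1) by auto
    have eq: "(\<lambda>c. \<Oplus>f\<in>insert f F'. coord R (i, f) c \<otimes> f)
      = coord R (i, f) \<otimes>\<^bsub>?B\<^esub> ?c f \<oplus>\<^bsub>?B\<^esub> (\<lambda>c. \<Oplus>f\<in>F'. coord R (i, f) c \<otimes> f)"
    proof
      fix c
      have "(\<Oplus>f\<in>insert f F'. coord R (i, f) c \<otimes> f) = coord R (i, f) c \<otimes> f \<oplus> (\<Oplus>f\<in>F'. coord R (i, f) c \<otimes> f)"
        using insert.hyps fc by (intro finsum_insert) auto
      then show "(\<Oplus>f\<in>insert f F'. coord R (i, f) c \<otimes> f)
        = (coord R (i, f) \<otimes>\<^bsub>?B\<^esub> ?c f \<oplus>\<^bsub>?B\<^esub> (\<lambda>c. \<Oplus>f\<in>F'. coord R (i, f) c \<otimes> f)) c" by simp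
    qed
    have co: "coord R (i, f) \<in> carrier ?B" using coord_in_poly_funs[of "(i, f)" vs] vs that(1) fF by simp
    have ih: "(\<lambda>c. \<Oplus>f\<in>F'. coord R (i, f) c \<otimes> f) \<in> carrier ?B" using insert by blast
    show ?case unfolding eq by (rule B.a_closed[OF B.m_closed[OF co cB[OF fc(1)]] ih])
  qed
  have VB: "V i \<in> carrier ?B" if "i < g" for i unfolding V_def by (rule part[OF that order_refl])
  \<comment> \<open>The generic counterpart of \<open>reduction_gens\<close>: \<open>W r\<close>
    below is the ideal V I^r + I^(r+2) over \<open>?B\<close>.\<close>
  define G where "G r = {V i \<otimes>\<^bsub>?B\<^esub> ?c z | i z. i < g \<and> z \<in> ?P r} \<union> ?c ` ?P (Suc (Suc r))" for r
  define W where "W r = Idl\<^bsub>?B\<^esub> (G r)" for r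
  have GB: "G r \<subseteq> carrier ?B" for r unfolding G_def using VB cB Pc B.m_closed by blast
  have W: "ideal (W r) ?B" for r unfolding W_def by (rule B.genideal_ideal[OF GB])
  have GW: "G r \<subseteq> W r" for r unfolding W_def by (rule B.genideal_self[OF GB])
  \<comment> \<open>This is the colon ideal of \<open>W r\<close> by I^(r+1) in \<open>?B\<close>,
    the obstruction to exponent r.\<close>
  define a where "a r = {b \<in> carrier ?B. \<forall>y\<in>?P (Suc r). ?c y \<otimes>\<^bsub>?B\<^esub> b \<in> W r}" for r
  \<comment> \<open>Contracting to \<open>R\<close> allows colon conditions to be checked on
    generators or on products of elements of \<open>R\<close>.\<close>
  have colon: "ideal {y \<in> carrier R. ?c y \<otimes>\<^bsub>?B\<^esub> b \<in> L} R" if "ideal L ?B" "b \<in> carrier ?B" for L b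
  proof -
    have "ideal {y \<in> carrier R. ?c y \<in> {x \<in> carrier ?B. x \<otimes>\<^bsub>?B\<^esub> b \<in> L}} R"
      by (rule const_vimage[OF B.ideal_colon[OF that]])
    moreover have "{y \<in> carrier R. ?c y \<in> {x \<in> carrier ?B. x \<otimes>\<^bsub>?B\<^esub> b \<in> L}}
        = {y \<in> carrier R. ?c y \<otimes>\<^bsub>?B\<^esub> b \<in> L}" using cB by blast
    ultimately show ?thesis by (simp only:)
  qed
  have a_ideal: "ideal (a r) ?B" for r
  proof (rule B.cring_idealI)
    interpret W: ideal "W r" ?B by (rule W)
    show "a r \<subseteq> carrier ?B" unfolding a_def by blast
    have "?c y \<otimes>\<^bsub>?B\<^esub> \<zero>\<^bsub>?B\<^esub> \<in> W r" if "y \<in> ?P (Suc r)" for y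
      unfolding B.r_null[OF cB[OF Pc[OF that]]] by (rule W.zero_closed)
    then show "\<zero>\<^bsub>?B\<^esub> \<in> a r" unfolding a_def using B.zero_closed by blast
  next
    interpret W: ideal "W r" ?B by (rule W)
    fix b b' assume b: "b \<in> a r" "b' \<in> a r"
    have "?c y \<otimes>\<^bsub>?B\<^esub> (b \<oplus>\<^bsub>?B\<^esub> b') \<in> W r" if "y \<in> ?P (Suc r)" for y
    proof -
      have "?c y \<otimes>\<^bsub>?B\<^esub> (b \<oplus>\<^bsub>?B\<^esub> b') = ?c y \<otimes>\<^bsub>?B\<^esub> b \<oplus>\<^bsub>?B\<^esub> ?c y \<otimes>\<^bsub>?B\<^esub> b'"
        using b cB[OF Pc[OF that]] unfolding a_def by (intro B.r_distr) auto
      also have "\<dots> \<in> W r" using b that unfolding a_def by (intro W.a_closed) auto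
      finally show ?thesis .
    qed
    then show "b \<oplus>\<^bsub>?B\<^esub> b' \<in> a r" using b B.a_closed unfolding a_def by blast
  next
    interpret W: ideal "W r" ?B by (rule W)
    fix b s assume b: "b \<in> a r" "s \<in> carrier ?B"
    have "?c y \<otimes>\<^bsub>?B\<^esub> (s \<otimes>\<^bsub>?B\<^esub> b) \<in> W r" if "y \<in> ?P (Suc r)" for y
    proof -
      have "?c y \<otimes>\<^bsub>?B\<^esub> (s \<otimes>\<^bsub>?B\<^esub> b) = s \<otimes>\<^bsub>?B\<^esub> (?c y \<otimes>\<^bsub>?B\<^esub> b)"
        using b cB[OF Pc[OF that]] unfolding a_def by (intro B.m_lcomm) auto
      also have "\<dots> \<in> W r" using W.I_l_closed[of "?c y \<otimes>\<^bsub>?B\<^esub> b" s] b that unfolding a_def by blast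
      finally show ?thesis .
    qed
    then show "s \<otimes>\<^bsub>?B\<^esub> b \<in> a r" using b B.m_closed unfolding a_def by blast
  qed
  have PS: "u \<otimes> v \<in> ?P (Suc n)" if "u \<in> I" "v \<in> ?P n" for u v n
    unfolding ideal_pow_Suc[OF I] by (rule ideal_prod.prod[OF that])
  have a_Suc: "a r \<subseteq> a (Suc r)" for r
  proof
    fix b assume b: "b \<in> a r"
    then have bB: "b \<in> carrier ?B" unfolding a_def by blast
    \<comment> \<open>Multiplication by an element of \<open>I\<close> raises each power of
      \<open>I\<close> among the generators by one, so it carries \<open>W r\<close> into
      \<open>W (Suc r)\<close>.\<close>
    have uW: "w \<otimes>\<^bsub>?B\<^esub> ?c u \<in> W (Suc r)" if u: "u \<in> I" and w: "w \<in> W r" for u w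
    proof -
      have uc: "u \<in> carrier R" using u I.Icarr by blast
      have "W r \<subseteq> {w \<in> carrier ?B. w \<otimes>\<^bsub>?B\<^esub> ?c u \<in> W (Suc r)}"
        unfolding W_def[of r]
      proof (rule B.genideal_minimal[OF B.ideal_colon[OF W cB[OF uc]]], rule subsetI)
        fix x assume x: "x \<in> G r"
        have "x \<otimes>\<^bsub>?B\<^esub> ?c u \<in> G (Suc r)"
        proof -
          consider i z where "i < g" "z \<in> ?P r" "x = V i \<otimes>\<^bsub>?B\<^esub> ?c z" | y where "y \<in> ?P (Suc (Suc r))" "x = ?c y"
            using x unfolding G_def by blast
          then show ?thesis
          proof cases
            case 1
            have "x \<otimes>\<^bsub>?B\<^esub> ?c u = V i \<otimes>\<^bsub>?B\<^esub> ?c (u \<otimes> z)"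
              unfolding 1(3) using VB[OF 1(1)] Pc[OF 1(2)] uc
              by (auto simp: fun_eq_iff m_ac poly_funs_carr)
            then show ?thesis unfolding G_def using 1 PS[OF u 1(2)] by blast
          next
            case 2
            have "x \<otimes>\<^bsub>?B\<^esub> ?c u = ?c (u \<otimes> y)"
              unfolding 2(2) using Pc[OF 2(1)] uc by (auto simp: fun_eq_iff m_comm)
            then show ?thesis unfolding G_def using PS[OF u 2(1)] by blast
          qed
        qed
        then show "x \<in> {w \<in> carrier ?B. w \<otimes>\<^bsub>?B\<^esub> ?c u \<in> W (Suc r)}" using x GB GW by blast
      qed
      then show ?thesis using w by blast
    qed
    have "?P (Suc (Suc r)) \<subseteq> {y \<in> carrier R. ?c y \<otimes>\<^bsub>?B\<^esub> b \<in> W (Suc r)}"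
      unfolding ideal_pow_Suc[OF I, of "Suc r"]
    proof (rule ideal_prod_subset[OF colon[OF W bB]])
      fix u v assume uv: "u \<in> I" "v \<in> ?P (Suc r)"
      have "?c (u \<otimes> v) \<otimes>\<^bsub>?B\<^esub> b = (?c v \<otimes>\<^bsub>?B\<^esub> b) \<otimes>\<^bsub>?B\<^esub> ?c u"
        using Pc[OF uv(2)] I.Icarr[OF uv(1)] bB by (auto simp: fun_eq_iff m_ac poly_funs_carr)
      also have "\<dots> \<in> W (Suc r)" using uW[OF uv(1)] uv(2) b unfolding a_def by blast
      finally show "u \<otimes> v \<in> {y \<in> carrier R. ?c y \<otimes>\<^bsub>?B\<^esub> b \<in> W (Suc r)}"
        using Pc[OF uv(2)] I.Icarr[OF uv(1)] by blast
    qed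
    then show "b \<in> a (Suc r)" unfolding a_def using bB by blast
  qed
  obtain N where N: "\<And>n. n \<ge> N \<Longrightarrow> a n = a N"
    using B.ascending_ideals_stable[of a] a_ideal a_Suc by blast
  show thesis
  proof (rule that[of N])

    \<comment> \<open>Specialization to given elements\<close>
    fix h r k
    assume h: "h ` {..<g} \<subseteq> I" and red: "?P (Suc r) \<subseteq> Idl (reduction_gens R I g h r)" and k: "N \<le> k"
    have hc: "h i \<in> carrier R" if "i < g" for i using h that I.Icarr by blast
    have "\<exists>c. (\<forall>f. c f \<in> carrier R) \<and> h i = (\<Oplus>f\<in>F. c f \<otimes> f)" if "i < g" for i
      using genideal_finite_finsum[OF F(2,1)] h that F(3) by blast
    then obtain \<gamma>' where \<gamma>': "\<And>i f. i < g \<Longrightarrow> \<gamma>' i f \<in> carrier R"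
      "\<And>i. i < g \<Longrightarrow> h i = (\<Oplus>f\<in>F. \<gamma>' i f \<otimes> f)" by metis
    \<comment> \<open>The point at which the generic \<open>V i\<close> takes the value
      \<open>h i\<close>.\<close>
    define \<gamma> where "\<gamma> = (\<lambda>(i, f). \<gamma>' i f)"
    have co: "coord R (i, f) \<gamma> = \<gamma>' i f" if "i < g" for i f
      using \<gamma>'(1)[OF that] unfolding coord_def \<gamma>_def by simp
    have V\<gamma>: "V i \<gamma> = h i" if "i < g" for i unfolding V_def \<gamma>'(2)[OF that] co[OF that] ..
    have genc: "reduction_gens R I g h n \<subseteq> carrier R" for n
      using reduction_gens_carr[OF I] hc by blast
    \<comment> \<open>The kernel of evaluation at \<open>\<gamma>\<close>; it plays the part of the
      small ideal in Nakayama's lemma.\<close>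
    define P0 where "P0 = {b \<in> carrier ?B. b \<gamma> \<in> {\<zero>}}"
    have P0: "ideal P0 ?B" unfolding P0_def by (rule eval_vimage[OF zeroideal])
    obtain S where S: "S \<subseteq> carrier R" "finite S" "?P (Suc r) = Idl S" using finetely_gen[OF P] by blast
    obtain gs where gs: "set gs = S" using finite_list[OF S(2)] by blast
    define Gs where "Gs = map ?c gs"
    have Gs: "set Gs \<subseteq> carrier ?B" unfolding Gs_def using S(1) gs cB by auto
    \<comment> \<open>\<open>L\<close> is W_r + P0 I^(r+1), with the power of \<open>I\<close>
      extended to \<open>?B\<close>.\<close>
    define L where "L = lin_span ?B P0 (W r) Gs"
    have L: "ideal L ?B" unfolding L_def by (rule B.lin_span_ideal[OF P0 W Gs])
    interpret L: ideal L ?B by (rule L)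
    have WL: "W r \<subseteq> L" unfolding L_def by (rule B.lin_span_base[OF P0 W Gs])
    have PL: "?c y \<otimes>\<^bsub>?B\<^esub> p \<in> L" if "p \<in> P0" "y \<in> ?P (Suc r)" for p y
    proof -
      have pB: "p \<in> carrier ?B" using that(1) P0_def by blast
      have "?P (Suc r) \<subseteq> {y \<in> carrier R. ?c y \<otimes>\<^bsub>?B\<^esub> p \<in> L}"
        unfolding S(3)
      proof (rule genideal_minimal[OF colon[OF L pB]], rule subsetI)
        fix s assume s: "s \<in> S"
        have "p \<otimes>\<^bsub>?B\<^esub> ?c s \<in> L" unfolding L_def
          by (rule B.lin_span_mem[OF P0 W Gs that(1)]) (use s gs Gs_def in auto)
        moreover have sc: "s \<in> carrier R" using S(1) s by blast
        ultimately have "?c s \<otimes>\<^bsub>?B\<^esub> p \<in> L" unfolding B.m_comm[OF cB[OF sc] pB] by blast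
        then show "s \<in> {y \<in> carrier R. ?c y \<otimes>\<^bsub>?B\<^esub> p \<in> L}" using S(1) s by blast
      qed
      then show ?thesis using that(2) by blast
    qed
    \<comment> \<open>Summand by summand, V_i z - h_i z lies in P0 I^(r+1): a coordinate differs
      from its value at \<open>\<gamma>\<close> by an element of \<open>P0\<close>, and f z is in
      I^(r+1).\<close>
    have diff: "(\<lambda>c. (\<Oplus>f\<in>F'. coord R (i, f) c \<otimes> f) \<otimes> z \<ominus> (\<Oplus>f\<in>F'. \<gamma>' i f \<otimes> f) \<otimes> z) \<in> L"
      if i: "i < g" and z: "z \<in> ?P r" and F': "F' \<subseteq> F" for i z F'
      using finite_subset[OF F' F(2)] F'
    proof (induction F')
      case empty
      have "(\<lambda>c. (\<Oplus>f\<in>{}. coord R (i, f) c \<otimes> f) \<otimes> z \<ominus> (\<Oplus>f\<in>{}. \<gamma>' i f \<otimes> f) \<otimes> z) = \<zero>\<^bsub>?B\<^esub>"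
        using Pc[OF z] by (simp add: minus_eq)
      then show ?case using L.zero_closed by (simp only:)
    next
      case (insert f F')
      have fc: "f \<in> carrier R" and F'c: "F' \<subseteq> carrier R" and fF: "f \<in> F" using insert F(1) by auto
      have zc: "z \<in> carrier R" using Pc[OF z] .
      let ?p = "coord R (i, f) \<ominus>\<^bsub>?B\<^esub> ?c (\<gamma>' i f)"
      have coB: "coord R (i, f) \<in> carrier ?B" using coord_in_poly_funs[of "(i, f)" vs] vs i fF by auto
      have pB: "?p \<in> carrier ?B" using coB cB[OF \<gamma>'(1)[OF i]] by (rule B.minus_closed)
      have pc: "?p c = coord R (i, f) c \<ominus> \<gamma>' i f" for c
        using poly_fun_ring_minus[OF coB cB[OF \<gamma>'(1)[OF i]]] .
      have "?p \<gamma> = \<zero>" unfolding pc co[OF i] using \<gamma>'(1)[OF i] by (simp add: minus_eq r_neg)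
      then have pP: "?p \<in> P0" unfolding P0_def using pB by blast
      have fz: "f \<otimes> z \<in> ?P (Suc r)" using PS fF FI z by blast
      have s1: "(\<Oplus>f\<in>F'. coord R (i, f) c \<otimes> f) \<in> carrier R" for c
        using F'c by (auto intro!: finsum_closed)
      have s2: "(\<Oplus>f\<in>F'. \<gamma>' i f \<otimes> f) \<in> carrier R"
        using F'c \<gamma>'(1)[OF i] by (auto intro!: finsum_closed)
      have e1: "(\<Oplus>f\<in>insert f F'. coord R (i, f) c \<otimes> f) = coord R (i, f) c \<otimes> f \<oplus> (\<Oplus>f\<in>F'. coord R (i, f) c \<otimes> f)" for c
        using insert.hyps F'c fc by (intro finsum_insert) auto
      have e2: "(\<Oplus>f\<in>insert f F'. \<gamma>' i f \<otimes> f) = \<gamma>' i f \<otimes> f \<oplus> (\<Oplus>f\<in>F'. \<gamma>' i f \<otimes> f)"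
        using insert.hyps F'c fc \<gamma>'(1)[OF i] by (intro finsum_insert) auto
      have "(u \<otimes> f \<oplus> s) \<otimes> z \<ominus> (v \<otimes> f \<oplus> t) \<otimes> z = (f \<otimes> z) \<otimes> (u \<ominus> v) \<oplus> (s \<otimes> z \<ominus> t \<otimes> z)"
        if "u \<in> carrier R" "v \<in> carrier R" "s \<in> carrier R" "t \<in> carrier R" for u v s t
        using that zc fc by algebra
      then have "(\<lambda>c. (\<Oplus>f\<in>insert f F'. coord R (i, f) c \<otimes> f) \<otimes> z \<ominus> (\<Oplus>f\<in>insert f F'. \<gamma>' i f \<otimes> f) \<otimes> z)
        = (?c (f \<otimes> z) \<otimes>\<^bsub>?B\<^esub> ?p) \<oplus>\<^bsub>?B\<^esub> (\<lambda>c. (\<Oplus>f\<in>F'. coord R (i, f) c \<otimes> f) \<otimes> z \<ominus> (\<Oplus>f\<in>F'. \<gamma>' i f \<otimes> f) \<otimes> z)"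
        unfolding e1 e2 using s1 s2 \<gamma>'(1)[OF i] by (simp add: fun_eq_iff pc)
      also have "\<dots> \<in> L" using insert by (intro L.a_closed[OF PL[OF pP fz]]) blast
      finally show ?case .
    qed
    \<comment> \<open>The containment assumed for \<open>h\<close> lifts to \<open>?B\<close>:
      modulo \<open>L\<close> the products h_i z agree with V_i z, which lie in \<open>W r\<close>
      together with I^(r+2).\<close>
    have cL: "?c y \<in> L" if "y \<in> ?P (Suc r)" for y
    proof -
      have id: "ideal {y \<in> carrier R. ?c y \<in> L} R" by (rule const_vimage[OF L])
      have "reduction_gens R I g h r \<subseteq> {y \<in> carrier R. ?c y \<in> L}"
      proof
        fix x assume x: "x \<in> reduction_gens R I g h r"
        then consider i z where "i < g" "z \<in> ?P r" "x = h i \<otimes> z" | "x \<in> ?P (Suc (Suc r))"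
          unfolding reduction_gens_def by blast
        then have "?c x \<in> L"
        proof cases
          case 1
          let ?D = "\<lambda>c. (\<Oplus>f\<in>F. coord R (i, f) c \<otimes> f) \<otimes> z \<ominus> (\<Oplus>f\<in>F. \<gamma>' i f \<otimes> f) \<otimes> z"
          have D: "?D \<in> L" using diff[OF 1(1,2)] by blast
          have VL: "V i \<otimes>\<^bsub>?B\<^esub> ?c z \<in> L" using 1 GW WL unfolding G_def by blast
          have VB': "V i \<otimes>\<^bsub>?B\<^esub> ?c z \<in> carrier ?B" "?c x \<in> carrier ?B"
            using L.Icarr[OF VL] cB x genc by blast+
          have "?D \<oplus>\<^bsub>?B\<^esub> ?c x = V i \<otimes>\<^bsub>?B\<^esub> ?c z"
          proof
            fix c
            have "V i c \<in> carrier R" using VB[OF 1(1)] poly_funs_carr by simp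
            then have "V i c \<otimes> z \<ominus> h i \<otimes> z \<oplus> h i \<otimes> z = V i c \<otimes> z" using hc[OF 1(1)] Pc[OF 1(2)] by algebra
            then show "(?D \<oplus>\<^bsub>?B\<^esub> ?c x) c = (V i \<otimes>\<^bsub>?B\<^esub> ?c z) c"
              using \<gamma>'(2)[OF 1(1)] 1(3) by (simp add: V_def)
          qed
          then have "?c x = (V i \<otimes>\<^bsub>?B\<^esub> ?c z) \<ominus>\<^bsub>?B\<^esub> ?D"
            using B.add_minus_cancel_left[OF L.Icarr[OF D] VB'(2)] by (simp only:)
          then show ?thesis using L.ideal_minus_closed[OF VL D] by (simp only:)
        next
          case 2
          then show ?thesis using GW WL unfolding G_def by blast
        qed
        then show "x \<in> {y \<in> carrier R. ?c y \<in> L}" using x genc by blast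
      qed
      then show ?thesis using that red genideal_minimal[OF id] by blast
    qed
    \<comment> \<open>Nakayama's lemma, started at the factor 1, yields \<open>b\<close> in
      \<open>a r\<close> with value 1 at \<open>\<gamma>\<close>.\<close>
    have "\<exists>b\<in>carrier ?B. b \<ominus>\<^bsub>?B\<^esub> \<one>\<^bsub>?B\<^esub> \<in> P0 \<and> (\<forall>g\<in>set Gs. b \<otimes>\<^bsub>?B\<^esub> g \<in> W r)"
    proof (rule B.lin_span_nakayama[OF P0 W Gs B.one_closed])
      show "\<one>\<^bsub>?B\<^esub> \<ominus>\<^bsub>?B\<^esub> \<one>\<^bsub>?B\<^esub> \<in> P0"
        using additive_subgroup.zero_closed[OF ideal.axioms(1)[OF P0]] B.r_neg[OF B.one_closed]
        by (simp only: B.minus_eq)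
      fix x assume x: "x \<in> set Gs"
      then obtain s where s: "s \<in> S" "x = ?c s" unfolding Gs_def using gs by auto
      then have "x \<in> L" using cL S(1,3) genideal_self by blast
      moreover have xc: "x \<in> carrier ?B" using Gs x by blast
      ultimately show "\<one>\<^bsub>?B\<^esub> \<otimes>\<^bsub>?B\<^esub> x \<in> lin_span ?B P0 (W r) Gs"
        unfolding L_def B.l_one[OF xc] by blast
    qed
    then obtain b where b: "b \<in> carrier ?B" "b \<ominus>\<^bsub>?B\<^esub> \<one>\<^bsub>?B\<^esub> \<in> P0"
      and bg: "\<And>x. x \<in> set Gs \<Longrightarrow> b \<otimes>\<^bsub>?B\<^esub> x \<in> W r" by blast
    have "?P (Suc r) \<subseteq> {y \<in> carrier R. ?c y \<otimes>\<^bsub>?B\<^esub> b \<in> W r}"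
      unfolding S(3)
    proof (rule genideal_minimal[OF colon[OF W b(1)]], rule subsetI)
      fix s assume s: "s \<in> S"
      have "b \<otimes>\<^bsub>?B\<^esub> ?c s \<in> W r" by (rule bg) (use s gs Gs_def in auto)
      moreover have sc: "s \<in> carrier R" using S(1) s by blast
      ultimately have "?c s \<otimes>\<^bsub>?B\<^esub> b \<in> W r" unfolding B.m_comm[OF cB[OF sc] b(1)] by blast
      then show "s \<in> {y \<in> carrier R. ?c y \<otimes>\<^bsub>?B\<^esub> b \<in> W r}" using S(1) s by blast
    qed
    then have "b \<in> a r" unfolding a_def using b(1) by blast
    \<comment> \<open>This holds also for r beyond k, since both ideals then equal the stationary
      one.\<close>
    moreover have "a r \<subseteq> a k"
      using lift_Suc_mono_le[of a, OF a_Suc] N[of r] N[OF k] by (metis linear)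
    ultimately have ba: "b \<in> a k" by blast
    have b\<gamma>: "b \<gamma> = \<one>"
    proof -
      have "(b \<ominus>\<^bsub>?B\<^esub> \<one>\<^bsub>?B\<^esub>) \<gamma> = b \<gamma> \<ominus> \<one>"
        using poly_fun_ring_minus[OF b(1) B.one_closed] by simp
      then have "b \<gamma> \<ominus> \<one> = \<zero>" using b(2) unfolding P0_def by simp
      moreover have "b \<gamma> \<in> carrier R" using b(1) poly_funs_carr by simp
      ultimately show ?thesis by simp
    qed
    show "?P (Suc k) \<subseteq> Idl (reduction_gens R I g h k)"
    proof
      fix y assume y: "y \<in> ?P (Suc k)"
      let ?K = "Idl (reduction_gens R I g h k)"
      \<comment> \<open>Evaluation at \<open>\<gamma>\<close> sends the generic generators to those
        built from \<open>h\<close>, and sends y b to y.\<close>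
      have "W k \<subseteq> {w \<in> carrier ?B. w \<gamma> \<in> ?K}"
        unfolding W_def
      proof (rule B.genideal_minimal[OF eval_vimage[OF genideal_ideal[OF genc]]], rule subsetI)
        fix x assume x: "x \<in> G k"
        then consider i z where "i < g" "z \<in> ?P k" "x = V i \<otimes>\<^bsub>?B\<^esub> ?c z" | y where "y \<in> ?P (Suc (Suc k))" "x = ?c y"
          unfolding G_def by blast
        then have "x \<gamma> \<in> reduction_gens R I g h k"
        proof cases
          case 1
          have "x \<gamma> = h i \<otimes> z" unfolding 1(3) using V\<gamma>[OF 1(1)] by simp
          then show ?thesis unfolding reduction_gens_def using 1 by blast
        next
          case 2 then show ?thesis unfolding reduction_gens_def by blast
        qed
        then show "x \<in> {w \<in> carrier ?B. w \<gamma> \<in> ?K}" using x GB genideal_self[OF genc] by blast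
      qed
      moreover have "?c y \<otimes>\<^bsub>?B\<^esub> b \<in> W k" using ba y unfolding a_def by blast
      ultimately have "(?c y \<otimes>\<^bsub>?B\<^esub> b) \<gamma> \<in> ?K" by blast
      then show "y \<in> ?K" using b\<gamma> Pc[OF y] by simp
    qed
  qed
qed

text \<open>Modulo I^2 a reduction \<open>J\<close> is generated by \<open>g\<close> of its
  elements, so for all k \<ge> N, I^(k+1) lies in J + I^(k+2), with \<open>N\<close> independent of
  \<open>J\<close>. Some power of \<open>I\<close> lies in \<open>J\<close>, and descending from it
  one exponent at a time ends at I^(N+1).\<close>

theorem (in noetherian_cring) power_subset_reductions:
  assumes I: "ideal I R" and mx: "primes_above_maximal R I"
  obtains N where "\<And>J. is_reduction R J I \<Longrightarrow> ideal_pow R I N \<subseteq> J"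
proof -
  interpret I: ideal I R by (rule I)
  let ?P = "ideal_pow R I"
  have P: "ideal (?P n) R" for n by (rule ideal_pow_ideal[OF I])
  obtain g :: nat where g: "\<And>N. ideal N R \<Longrightarrow> \<exists>h. h ` {..<g} \<subseteq> N \<and> N \<subseteq> Idl (h ` {..<g} \<union> ?P (Suc (Suc 0)))"
    using bounded_generation_mod[OF P primes_above_maximal_pow[OF I mx]] by blast
  obtain N where N: "\<And>h r k. \<lbrakk>h ` {..<g} \<subseteq> I; ?P (Suc r) \<subseteq> Idl (reduction_gens R I g h r); N \<le> k\<rbrakk>
    \<Longrightarrow> ?P (Suc k) \<subseteq> Idl (reduction_gens R I g h k)"
    using uniform_reduction_number[OF I] by blast
  show thesis
  proof (rule that[of "Suc N"])
    fix J assume J: "is_reduction R J I"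
    then obtain r where JI: "ideal J R" "J \<subseteq> I" and r: "?P (Suc r) = J \<cdot> ?P r"
      unfolding is_reduction_def by auto
    interpret J: ideal J R by (rule JI)
    obtain h where h: "h ` {..<g} \<subseteq> J" "J \<subseteq> Idl (h ` {..<g} \<union> ?P (Suc (Suc 0)))" using g[OF JI(1)] by blast
    have hc: "h ` {..<g} \<subseteq> carrier R" using h(1) J.Icarr by blast
    have genc: "reduction_gens R I g h n \<subseteq> carrier R" for n
      using reduction_gens_carr[OF I] hc by blast
    \<comment> \<open>In I^(r+1) = J I^r the ideal \<open>J\<close> may be replaced by its chosen
      elements, at the cost of I^2 I^r = I^(r+2).\<close>
    have "?P (Suc r) \<subseteq> Idl (reduction_gens R I g h r)"
      unfolding r
    proof (rule ideal_prod_subset[OF genideal_ideal[OF genc]])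
      fix x z assume x: "x \<in> J" and z: "z \<in> ?P r"
      have zc: "z \<in> carrier R" using ideal.Icarr[OF P z] .
      let ?K = "{x \<in> carrier R. x \<otimes> z \<in> Idl (reduction_gens R I g h r)}"
      have "h ` {..<g} \<union> ?P (Suc (Suc 0)) \<subseteq> ?K"
      proof
        fix y assume y: "y \<in> h ` {..<g} \<union> ?P (Suc (Suc 0))"
        then have yc: "y \<in> carrier R" using hc ideal.Icarr[OF P] by blast
        have "y \<otimes> z \<in> reduction_gens R I g h r"
        proof (cases "y \<in> h ` {..<g}")
          case True then show ?thesis unfolding reduction_gens_def using z by blast
        next
          case False
          then have "y \<in> ?P (Suc (Suc 0))" using y by blast
          then have "y \<otimes> z \<in> ?P (Suc (Suc 0)) \<cdot> ?P r" using z by (rule ideal_prod.prod)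
          also have "\<dots> = ?P (Suc (Suc r))"
            by (simp only: ideal_pow_Suc[OF I] ideal_pow_0 ideal_prod_one[OF I] ideal_prod_assoc[OF I I P])
          finally show ?thesis unfolding reduction_gens_def by blast
        qed
        then show "y \<in> ?K" using genideal_self[OF genc] yc by blast
      qed
      then have "Idl (h ` {..<g} \<union> ?P (Suc (Suc 0))) \<subseteq> ?K"
        by (rule genideal_minimal[OF ideal_colon[OF genideal_ideal[OF genc] zc]])
      then show "x \<otimes> z \<in> Idl (reduction_gens R I g h r)" using x h(2) by blast
    qed
    moreover have "h ` {..<g} \<subseteq> I" using h(1) JI(2) by blast
    ultimately have step: "?P (Suc k) \<subseteq> Idl (reduction_gens R I g h k)" if "N \<le> k" for k
      using N that by blast
    have down: "?P (Suc k) \<subseteq> J" if "?P (Suc (Suc k)) \<subseteq> J" "N \<le> k" for k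
    proof -
      have "reduction_gens R I g h k \<subseteq> J"
        unfolding reduction_gens_def using that(1) h(1) J.I_r_closed ideal.Icarr[OF P] by blast
      then show ?thesis using step[OF that(2)] genideal_minimal[OF JI(1)] by blast
    qed
    have "?P (Suc r) \<subseteq> J"
      unfolding r by (rule ideal_prod_subset[OF JI(1)]) (auto intro: J.I_r_closed ideal.Icarr[OF P])
    \<comment> \<open>Starting at exponent N + r + 1 keeps every step of the descent in the range k
      \<ge> N.\<close>
    then have "?P (Suc (N + r)) \<subseteq> J" using ideal_pow_antimono[OF I, of "Suc r" "Suc (N + r)"] by auto
    then show "?P (Suc N) \<subseteq> J"
    proof (induction r)
      case (Suc r) then show ?case using down[of "N + r"] by simp
    qed simp
  qed
qed

section \<open>Reductions under localization\<close>

context ring_with_mult_set begin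

lemma one_S [simp]: "\<one> \<in> S"
  by (rule one_closed)

lemma S_mult [simp]: "\<lbrakk>s \<in> S; t \<in> S\<rbrakk> \<Longrightarrow> s \<otimes> t \<in> S"
  by (rule m_closed)

section \<open>Extension and contraction of ideals\<close>

text \<open>\<open>loc_ideal\<close> requires a numerator in \<open>I\<close> only for some
  representation of the fraction. For an arbitrary representation this leaves a factor from
  \<open>S\<close>.\<close>

lemma loc_frac_mem_loc_ideal_iff:
  assumes I: "ideal I R" and a: "a \<in> carrier R" "s \<in> S"
  shows "loc_frac R S a s \<in> loc_ideal R S I \<longleftrightarrow> (\<exists>t\<in>S. t \<otimes> a \<in> I)"
proof
  interpret I: ideal I R by (rule I)
  assume "loc_frac R S a s \<in> loc_ideal R S I"
  then obtain b t where b: "b \<in> I" "t \<in> S" "loc_frac R S a s = loc_frac R S b t"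
    unfolding loc_ideal_def by auto
  have bc: "b \<in> carrier R" by (rule I.Icarr[OF b(1)])
  obtain u where u: "u \<in> S" "u \<otimes> (a \<otimes> t) = u \<otimes> (b \<otimes> s)"
    using b(3) loc_frac_eq_iff[OF a(1) bc a(2) b(2)] by blast
  have "(u \<otimes> t) \<otimes> a = u \<otimes> (a \<otimes> t)" using u(1) b(2) a by (simp add: m_ac)
  also have "\<dots> = (u \<otimes> s) \<otimes> b" unfolding u(2) using u(1) bc a by (simp add: m_ac)
  also have "\<dots> \<in> I" using b(1) u(1) a(2) by (intro I.I_l_closed) auto
  finally show "\<exists>t\<in>S. t \<otimes> a \<in> I" using u(1) b(2) S_mult by blast
next
  assume "\<exists>t\<in>S. t \<otimes> a \<in> I"
  then obtain t where t: "t \<in> S" "t \<otimes> a \<in> I" by blast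
  have "loc_frac R S a s = loc_frac R S (t \<otimes> a) (t \<otimes> s)"
    using t(1) a by (intro loc_frac_eqI) (auto simp: m_ac)
  then show "loc_frac R S a s \<in> loc_ideal R S I"
    unfolding loc_ideal_def using t a(2) S_mult by blast
qed

lemma loc_ideal_mono: "I \<subseteq> J \<Longrightarrow> loc_ideal R S I \<subseteq> loc_ideal R S J"
  unfolding loc_ideal_def by blast

lemma loc_frac_mem_loc_ideal: "\<lbrakk>a \<in> I; s \<in> S\<rbrakk> \<Longrightarrow> loc_frac R S a s \<in> loc_ideal R S I"
  unfolding loc_ideal_def by blast

lemma loc_ideal_carrier: "loc_ideal R S (carrier R) = carrier (localization R S)"
  unfolding loc_ideal_def carrier_localization ..

lemma loc_ideal_ideal:
  assumes I: "ideal I R" shows "ideal (loc_ideal R S I) (localization R S)"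
proof -
  interpret I: ideal I R by (rule I)
  interpret L: cring "localization R S" by (rule cring_localization)
  show ?thesis
  proof (rule L.cring_idealI)
    show "loc_ideal R S I \<subseteq> carrier (localization R S)"
      unfolding loc_ideal_def carrier_localization using I.Icarr by blast
    show "\<zero>\<^bsub>localization R S\<^esub> \<in> loc_ideal R S I"
      unfolding loc_zero by (rule loc_frac_mem_loc_ideal) auto
  next
    fix x y assume "x \<in> loc_ideal R S I" "y \<in> loc_ideal R S I"
    then obtain a s b t where *: "x = loc_frac R S a s" "a \<in> I" "s \<in> S"
      "y = loc_frac R S b t" "b \<in> I" "t \<in> S" unfolding loc_ideal_def by blast
    show "x \<oplus>\<^bsub>localization R S\<^esub> y \<in> loc_ideal R S I"
      unfolding *(1,4) using * I.Icarr
      by (simp add: loc_add_frac loc_frac_mem_loc_ideal I.I_r_closed)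
  next
    fix x r assume "x \<in> loc_ideal R S I" "r \<in> carrier (localization R S)"
    then obtain a s b t where *: "x = loc_frac R S a s" "a \<in> I" "s \<in> S"
      "r = loc_frac R S b t" "b \<in> carrier R" "t \<in> S"
      unfolding loc_ideal_def carrier_localization by blast
    show "r \<otimes>\<^bsub>localization R S\<^esub> x \<in> loc_ideal R S I"
      unfolding *(1,4) using * I.Icarr
      by (simp add: loc_mult_frac loc_frac_mem_loc_ideal I.I_l_closed)
  qed
qed

lemma loc_ideal_prod:
  assumes I: "ideal I R" and J: "ideal J R"
  shows "loc_ideal R S (I \<cdot> J) = loc_ideal R S I \<cdot>\<^bsub>localization R S\<^esub> loc_ideal R S J"
proof
  interpret I: ideal I R by (rule I)
  interpret J: ideal J R by (rule J)
  interpret L: cring "localization R S" by (rule cring_localization)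
  note IJ = ideal_prod_is_ideal[OF I J]
  show "loc_ideal R S (I \<cdot> J) \<subseteq> loc_ideal R S I \<cdot>\<^bsub>localization R S\<^esub> loc_ideal R S J"
  proof
    fix x assume "x \<in> loc_ideal R S (I \<cdot> J)"
    then obtain a s where a: "x = loc_frac R S a s" "a \<in> I \<cdot> J" "s \<in> S" unfolding loc_ideal_def by blast
    from a(2) have "loc_frac R S a s \<in> loc_ideal R S I \<cdot>\<^bsub>localization R S\<^esub> loc_ideal R S J"
    proof induction
      case (prod i j)
      have "loc_frac R S (i \<otimes> j) s = loc_frac R S i s \<otimes>\<^bsub>localization R S\<^esub> loc_frac R S j \<one>"
        using prod I.Icarr J.Icarr a(3) by (simp add: loc_mult_frac)
      then show ?case
        using prod a(3) by (simp add: ideal_prod.prod loc_frac_mem_loc_ideal)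
    next
      case (sum b c)
      have bc: "b \<in> carrier R" "c \<in> carrier R" using sum(1,2) ideal.Icarr[OF IJ] by auto
      \<comment> \<open>The denominator s is fixed throughout the induction, so both summands carry
        it and the fraction is expanded by s.\<close>
      have "loc_frac R S (b \<oplus> c) s = loc_frac R S (b \<otimes> s \<oplus> c \<otimes> s) (s \<otimes> s)"
        using bc a(3) by (intro loc_frac_eqI) (auto simp: l_distr r_distr m_ac)
      also have "\<dots> = loc_frac R S b s \<oplus>\<^bsub>localization R S\<^esub> loc_frac R S c s"
        using bc a(3) by (simp add: loc_add_frac)
      also have "\<dots> \<in> loc_ideal R S I \<cdot>\<^bsub>localization R S\<^esub> loc_ideal R S J"
        by (rule ideal_prod.sum[OF sum(3,4)])
      finally show ?case .
    qed
    then show "x \<in> loc_ideal R S I \<cdot>\<^bsub>localization R S\<^esub> loc_ideal R S J" using a(1) by simp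
  qed
  show "loc_ideal R S I \<cdot>\<^bsub>localization R S\<^esub> loc_ideal R S J \<subseteq> loc_ideal R S (I \<cdot> J)"
  proof (rule L.ideal_prod_subset[OF loc_ideal_ideal[OF IJ]])
    fix x y assume "x \<in> loc_ideal R S I" "y \<in> loc_ideal R S J"
    then obtain a s b t where *: "x = loc_frac R S a s" "a \<in> I" "s \<in> S"
      "y = loc_frac R S b t" "b \<in> J" "t \<in> S" unfolding loc_ideal_def by blast
    show "x \<otimes>\<^bsub>localization R S\<^esub> y \<in> loc_ideal R S (I \<cdot> J)"
      unfolding *(1,4) using * I.Icarr J.Icarr
      by (simp add: loc_mult_frac loc_frac_mem_loc_ideal ideal_prod.prod)
  qed
qed

lemma loc_ideal_pow:
  assumes I: "ideal I R"
  shows "loc_ideal R S (ideal_pow R I n) = ideal_pow (localization R S) (loc_ideal R S I) n"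
proof (induction n)
  case 0
  show ?case
    unfolding ideal_pow_0 cring.ideal_pow_0[OF cring_localization] by (rule loc_ideal_carrier)
next
  case (Suc n)
  show ?case
    unfolding ideal_pow_Suc[OF I] cring.ideal_pow_Suc[OF cring_localization loc_ideal_ideal[OF I]]
      loc_ideal_prod[OF I ideal_pow_ideal[OF I]] Suc.IH ..
qed

lemma loc_frac_ring_hom: "ring_hom_ring R (localization R S) (\<lambda>a. loc_frac R S a \<one>)"
  by (rule ring_hom_ringI2[OF ring_axioms cring.axioms(1)[OF cring_localization]], rule ring_hom_memI)
    (auto simp: loc_mult_frac loc_add_frac loc_one)

lemma loc_frac_numerator_mem:
  assumes K: "ideal K (localization R S)" and a: "a \<in> carrier R" "s \<in> S"
    and "loc_frac R S a s \<in> K"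
  shows "loc_frac R S a \<one> \<in> K"
proof -
  have "loc_frac R S a \<one> = loc_frac R S s \<one> \<otimes>\<^bsub>localization R S\<^esub> loc_frac R S a s"
    using a by (simp add: loc_mult_frac) (intro loc_frac_eqI, auto simp: m_ac)
  then show ?thesis using ideal.I_l_closed[OF K assms(4), of "loc_frac R S s \<one>"] a by simp
qed

text \<open>Extending the contraction of \<open>K\<close> gives back \<open>K\<close>. Intersecting
  with \<open>I\<close> loses nothing, since each element of \<open>K\<close> can be expanded to
  have its numerator in \<open>I\<close>.\<close>

lemma loc_ideal_contraction:
  assumes I: "ideal I R" and K: "ideal K (localization R S)" "K \<subseteq> loc_ideal R S I"
  shows "loc_ideal R S ({a \<in> carrier R. loc_frac R S a \<one> \<in> K} \<inter> I) = K"
proof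
  interpret K: ideal K "localization R S" by (rule K)
  show "loc_ideal R S ({a \<in> carrier R. loc_frac R S a \<one> \<in> K} \<inter> I) \<subseteq> K"
  proof
    fix x assume "x \<in> loc_ideal R S ({a \<in> carrier R. loc_frac R S a \<one> \<in> K} \<inter> I)"
    then obtain a s where *: "x = loc_frac R S a s" "a \<in> carrier R" "loc_frac R S a \<one> \<in> K" "s \<in> S"
      unfolding loc_ideal_def by blast
    have "x = loc_frac R S \<one> s \<otimes>\<^bsub>localization R S\<^esub> loc_frac R S a \<one>"
      using * by (simp add: loc_mult_frac)
    then show "x \<in> K" using K.I_l_closed[OF *(3), of "loc_frac R S \<one> s"] *(4) by simp
  qed
  show "K \<subseteq> loc_ideal R S ({a \<in> carrier R. loc_frac R S a \<one> \<in> K} \<inter> I)"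
  proof
    fix x assume x: "x \<in> K"
    then obtain a s where as: "x = loc_frac R S a s" "a \<in> carrier R" "s \<in> S"
      using K.Icarr by (meson localization_cases)
    obtain t where t: "t \<in> S" "t \<otimes> a \<in> I"
      using x K(2) as loc_frac_mem_loc_ideal_iff[OF I as(2,3)] by blast
    have x': "x = loc_frac R S (t \<otimes> a) (t \<otimes> s)"
      unfolding as(1) using as(2,3) t(1) by (intro loc_frac_eqI) (auto simp: m_ac)
    then have "loc_frac R S (t \<otimes> a) \<one> \<in> K"
      using x as t(1) by (intro loc_frac_numerator_mem[OF K(1), of _ "t \<otimes> s"]) auto
    then show "x \<in> loc_ideal R S ({a \<in> carrier R. loc_frac R S a \<one> \<in> K} \<inter> I)"
      unfolding x' using as t by (intro loc_frac_mem_loc_ideal) auto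
  qed
qed

text \<open>Extension commutes with products and powers, so the defining equation persists with the
  same exponent.\<close>

lemma loc_ideal_reduction:
  assumes I: "ideal I R" and J: "is_reduction R J I"
  shows "is_reduction (localization R S) (loc_ideal R S J) (loc_ideal R S I)"
proof -
  obtain r where r: "ideal J R" "J \<subseteq> I" "ideal_pow R I (r + 1) = J \<cdot> ideal_pow R I r"
    using J unfolding is_reduction_def by blast
  have "loc_ideal R S (ideal_pow R I (r + 1)) = loc_ideal R S (J \<cdot> ideal_pow R I r)"
    unfolding r(3) ..
  then have "ideal_pow (localization R S) (loc_ideal R S I) (r + 1)
      = loc_ideal R S J \<cdot>\<^bsub>localization R S\<^esub> ideal_pow (localization R S) (loc_ideal R S I) r"
    unfolding loc_ideal_prod[OF r(1) ideal_pow_ideal[OF I]] loc_ideal_pow[OF I] .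
  then show ?thesis
    unfolding is_reduction_def using loc_ideal_ideal[OF r(1)] loc_ideal_mono[OF r(2)] by blast
qed

end

section \<open>Reductions and the core in the Noetherian case\<close>

text \<open>\<open>I\<close> is a reduction of itself with exponent 0, so the core is an
  intersection of a nonempty family of ideals.\<close>

lemma (in cring) core_ideal:
  assumes I: "ideal I R" shows "ideal (core R I) R" "core R I \<subseteq> I"
proof -
  have "ideal_pow R I (0 + 1) = I \<cdot> ideal_pow R I 0"
    using ideal_pow_Suc[OF I, of 0] by simp
  then have red: "is_reduction R I I" unfolding is_reduction_def using I by blast
  then show "core R I \<subseteq> I" unfolding core_def by blast
  show "ideal (core R I) R" unfolding core_def
    by (rule i_Intersect) (use red in \<open>auto simp: is_reduction_def\<close>)
qed

locale noetherian_ring_with_mult_set = ring_with_mult_set + noetherian_ring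

sublocale noetherian_ring_with_mult_set \<subseteq> noetherian_cring
  by unfold_locales

context noetherian_ring_with_mult_set begin

text \<open>With J the contraction of \<open>K\<close> intersected with \<open>I\<close>, J I^r and
  I^(r+1) have the same extension. So each x in I^(r+1) has some t in \<open>S\<close> with tx in J
  I^r, and x splits as b(tx) + x(1 - tb), where 1 - tb is chosen to multiply \<open>I\<close> into
  J.\<close>

lemma contraction_reduction:
  assumes I: "ideal I R" and mx: "primes_above_maximal R I"
    and K: "is_reduction (localization R S) K (loc_ideal R S I)"
  shows "is_reduction R ({a \<in> carrier R. loc_frac R S a \<one> \<in> K} \<inter> I) I"
proof -
  interpret I: ideal I R by (rule I)
  interpret L: cring "localization R S" by (rule cring_localization)
  let ?P = "ideal_pow R I" and ?J = "{a \<in> carrier R. loc_frac R S a \<one> \<in> K} \<inter> I"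
  have P: "ideal (?P n) R" for n by (rule ideal_pow_ideal[OF I])
  obtain r where Ki: "ideal K (localization R S)" and KI: "K \<subseteq> loc_ideal R S I"
    and r: "ideal_pow (localization R S) (loc_ideal R S I) (Suc r)
      = K \<cdot>\<^bsub>localization R S\<^esub> ideal_pow (localization R S) (loc_ideal R S I) r"
    using K unfolding is_reduction_def by (metis Suc_eq_plus1)
  interpret K: ideal K "localization R S" by (rule Ki)
  have J: "ideal ?J R"
    by (intro i_intersect ring_hom_ring.ideal_vimage[OF loc_frac_ring_hom Ki] I)
  have JP: "ideal (?J \<cdot> ?P r) R" by (rule ideal_prod_is_ideal[OF J P])
  interpret JP: ideal "?J \<cdot> ?P r" R by (rule JP)
  have eq: "loc_ideal R S (?P (Suc r)) = loc_ideal R S (?J \<cdot> ?P r)"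
    unfolding loc_ideal_pow[OF I] r loc_ideal_prod[OF J P] loc_ideal_contraction[OF I Ki KI] ..
  have PK: "loc_ideal R S (?P (Suc r)) \<subseteq> K"
    unfolding loc_ideal_pow[OF I] r
    using L.ideal_prod_inter[OF Ki L.ideal_pow_ideal[OF loc_ideal_ideal[OF I]]] by blast
  have "x \<in> ?J \<cdot> ?P r" if x: "x \<in> ?P (Suc r)" for x
  proof -
    have xc: "x \<in> carrier R" by (rule ideal.Icarr[OF P x])
    have "loc_frac R S x \<one> \<in> loc_ideal R S (?J \<cdot> ?P r)"
      using x eq loc_frac_mem_loc_ideal[OF x one_S] by simp
    then obtain t where t: "t \<in> S" "t \<otimes> x \<in> ?J \<cdot> ?P r"
      using loc_frac_mem_loc_ideal_iff[OF JP xc one_S] by blast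
    have tc: "t \<in> carrier R" using t(1) by simp
    obtain k :: nat and b where b: "b \<in> carrier R" "t [^] k \<otimes> (\<one> \<ominus> t \<otimes> b) \<in> ?P (Suc r)"
      using power_one_minus_mem[OF P primes_above_maximal_pow[OF I mx] tc] by blast
    let ?e = "\<one> \<ominus> t \<otimes> b"
    have ec: "?e \<in> carrier R" using tc b(1) by simp
    have "t [^] k \<in> S" using t(1) by (induction k) auto
    \<comment> \<open>Since t^k is in \<open>S\<close>, \<open>?e\<close> lies in the extension of
      I^(r+1), hence in \<open>K\<close>; this is what makes \<open>?e\<close> multiply
      \<open>I\<close> into \<open>?J\<close>.\<close>
    then have "loc_frac R S ?e \<one> \<in> loc_ideal R S (?P (Suc r))"
      using loc_frac_mem_loc_ideal_iff[OF P ec one_S] b(2) by blast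
    then have eK: "loc_frac R S ?e \<one> \<in> K" using PK by blast
    have eJ: "y \<otimes> ?e \<in> ?J" if y: "y \<in> I" for y
    proof -
      have yc: "y \<in> carrier R" using I.Icarr y by blast
      have "loc_frac R S (y \<otimes> ?e) \<one> = loc_frac R S y \<one> \<otimes>\<^bsub>localization R S\<^esub> loc_frac R S ?e \<one>"
        using yc ec by (simp add: loc_mult_frac)
      also have "\<dots> \<in> K" by (rule K.I_l_closed[OF eK]) (simp add: yc)
      finally show ?thesis using yc ec y I.I_r_closed by blast
    qed
    have "I \<cdot> ?P r \<subseteq> {x \<in> carrier R. x \<otimes> ?e \<in> ?J \<cdot> ?P r}"
    proof (rule ideal_prod_subset[OF ideal_colon[OF JP ec]])
      fix y z assume y: "y \<in> I" and z: "z \<in> ?P r"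
      have c: "y \<in> carrier R" "z \<in> carrier R" using I.Icarr[OF y] ideal.Icarr[OF P z] by auto
      have "(y \<otimes> z) \<otimes> ?e = (y \<otimes> ?e) \<otimes> z" using c ec by (simp add: m_ac)
      also have "\<dots> \<in> ?J \<cdot> ?P r" by (rule ideal_prod.prod[OF eJ[OF y] z])
      finally show "y \<otimes> z \<in> {x \<in> carrier R. x \<otimes> ?e \<in> ?J \<cdot> ?P r}" using c by simp
    qed
    then have xe: "x \<otimes> ?e \<in> ?J \<cdot> ?P r" using x unfolding ideal_pow_Suc[OF I] by blast
    have "x = b \<otimes> (t \<otimes> x) \<oplus> x \<otimes> ?e" using xc tc b(1) by algebra
    also have "\<dots> \<in> ?J \<cdot> ?P r" by (rule JP.a_closed[OF JP.I_l_closed[OF t(2) b(1)] xe])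
    finally show ?thesis .
  qed
  moreover have "?J \<cdot> ?P r \<subseteq> ?P (Suc r)" unfolding ideal_pow_Suc[OF I] by (rule ideal_prod_mono) auto
  ultimately have "?P (r + 1) = ?J \<cdot> ?P r" by auto
  then show ?thesis unfolding is_reduction_def using J by blast
qed

text \<open>The elements that some member of \<open>S\<close> multiplies into \<open>M\<close> form
  the contraction of the extension of \<open>M\<close>. This ideal is finitely generated, and the
  product of the multipliers of its generators serves for all its elements.\<close>

lemma uniform_denominator:
  assumes "ideal M R"
  obtains t where "t \<in> S" "\<And>x s. \<lbrakk>x \<in> carrier R; s \<in> S; s \<otimes> x \<in> M\<rbrakk> \<Longrightarrow> t \<otimes> x \<in> M"
proof -
  interpret M: ideal M R by fact
  let ?Q = "{x \<in> carrier R. loc_frac R S x \<one> \<in> loc_ideal R S M}"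
  have Q: "ideal ?Q R" by (rule ring_hom_ring.ideal_vimage[OF loc_frac_ring_hom loc_ideal_ideal[OF assms]])
  then obtain A where A: "A \<subseteq> carrier R" "finite A" "?Q = Idl A" using finetely_gen by blast
  have "A \<subseteq> ?Q" using genideal_self[OF A(1)] A(3) by blast
  with A(2) have "\<exists>t\<in>S. \<forall>x\<in>A. t \<otimes> x \<in> M"
  proof induction
    case (insert x F)
    then obtain t where t: "t \<in> S" "\<forall>x\<in>F. t \<otimes> x \<in> M" by auto
    have xc: "x \<in> carrier R" using insert.prems by blast
    then obtain s where s: "s \<in> S" "s \<otimes> x \<in> M"
      using insert.prems loc_frac_mem_loc_ideal_iff[OF assms xc one_S] by blast
    have "(s \<otimes> t) \<otimes> y \<in> M" if y: "y \<in> insert x F" for y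
    proof (cases "y = x")
      case True
      have "(s \<otimes> t) \<otimes> x = t \<otimes> (s \<otimes> x)" using s(1) t(1) xc by (simp add: m_ac)
      then show ?thesis using True M.I_l_closed[OF s(2)] t(1) by simp
    next
      case False
      then have "y \<in> F" "y \<in> carrier R" using y insert.prems by auto
      moreover from this have "(s \<otimes> t) \<otimes> y = s \<otimes> (t \<otimes> y)" using s(1) t(1) by (simp add: m_ac)
      ultimately show ?thesis using M.I_l_closed t(2) s(1) by simp
    qed
    then show ?case using s(1) t(1) S_mult by blast
  qed (use one_S in blast)
  then obtain t where t: "t \<in> S" "\<forall>x\<in>A. t \<otimes> x \<in> M" by blast
  have tc: "t \<in> carrier R" using t(1) by simp
  have "A \<subseteq> {x \<in> carrier R. x \<otimes> t \<in> M}"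
  proof
    fix x assume x: "x \<in> A"
    then have "x \<in> carrier R" using A(1) by blast
    then show "x \<in> {x \<in> carrier R. x \<otimes> t \<in> M}" using t(2) x m_comm[OF _ tc, of x] by simp
  qed
  then have QM: "?Q \<subseteq> {x \<in> carrier R. x \<otimes> t \<in> M}"
    unfolding A(3) by (rule genideal_minimal[OF ideal_colon[OF assms tc]])
  show thesis
  proof (rule that[OF t(1)])
    fix x s assume x: "x \<in> carrier R" "s \<in> S" "s \<otimes> x \<in> M"
    then have "x \<in> ?Q" using loc_frac_mem_loc_ideal_iff[OF assms x(1) one_S] by blast
    then show "t \<otimes> x \<in> M" using QM m_comm[OF tc x(1)] by auto
  qed
qed

text \<open>Every reduction of the extended ideal contracts to a reduction of \<open>I\<close>,
  which contains the core; this gives one inclusion. For the other, a numerator must be multiplied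
  into all reductions at once by a single member of \<open>S\<close>, obtained from a power of
  \<open>I\<close> lying in all of them.\<close>

lemma core_localization:
  assumes I: "ideal I R" and mx: "primes_above_maximal R I"
  shows "core (localization R S) (loc_ideal R S I) = loc_ideal R S (core R I)"
proof
  interpret I: ideal I R by (rule I)
  interpret L: cring "localization R S" by (rule cring_localization)
  note core_id = core_ideal[OF I]
  show "loc_ideal R S (core R I) \<subseteq> core (localization R S) (loc_ideal R S I)"
    unfolding core_def[of "localization R S"]
  proof (rule Inter_greatest, drule CollectD)
    fix K assume K: "is_reduction (localization R S) K (loc_ideal R S I)"
    have "core R I \<subseteq> {a \<in> carrier R. loc_frac R S a \<one> \<in> K} \<inter> I"
      unfolding core_def using contraction_reduction[OF I mx K] by blast
    then have "loc_ideal R S (core R I) \<subseteq> loc_ideal R S ({a \<in> carrier R. loc_frac R S a \<one> \<in> K} \<inter> I)"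
      by (rule loc_ideal_mono)
    also have "\<dots> = K" using K unfolding is_reduction_def by (intro loc_ideal_contraction[OF I]) auto
    finally show "loc_ideal R S (core R I) \<subseteq> K" .
  qed
  show "core (localization R S) (loc_ideal R S I) \<subseteq> loc_ideal R S (core R I)"
  proof
    fix z assume z: "z \<in> core (localization R S) (loc_ideal R S I)"
    then have "z \<in> loc_ideal R S I" using L.core_ideal(2)[OF loc_ideal_ideal[OF I]] by blast
    then obtain x s where x: "z = loc_frac R S x s" "x \<in> I" "s \<in> S" unfolding loc_ideal_def by blast
    have xc: "x \<in> carrier R" using I.Icarr x(2) by blast
    obtain N where N: "\<And>J. is_reduction R J I \<Longrightarrow> ideal_pow R I N \<subseteq> J"
      using power_subset_reductions[OF I mx] by blast
    have P: "ideal (ideal_pow R I N) R" by (rule ideal_pow_ideal[OF I])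
    obtain t where t: "t \<in> S"
      and tM: "\<And>x s. \<lbrakk>x \<in> carrier R; s \<in> S; s \<otimes> x \<in> ideal_pow R I N\<rbrakk> \<Longrightarrow> t \<otimes> x \<in> ideal_pow R I N"
      using uniform_denominator[OF P] by blast
    have tc: "t \<in> carrier R" using t by simp
    have "t \<otimes> x \<in> J" if J: "is_reduction R J I" for J
    proof -
      have Ji: "ideal J R" using J unfolding is_reduction_def by blast
      interpret J: ideal J R by (rule Ji)
      have "z \<in> loc_ideal R S J" using z loc_ideal_reduction[OF I J] unfolding core_def by blast
      then obtain u where u: "u \<in> S" "u \<otimes> x \<in> J"
        unfolding x(1) using loc_frac_mem_loc_ideal_iff[OF Ji xc x(3)] by blast
      have uc: "u \<in> carrier R" using u(1) by simp
      obtain k :: nat and b where b: "b \<in> carrier R" "u [^] k \<otimes> (\<one> \<ominus> u \<otimes> b) \<in> ideal_pow R I N"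
        using power_one_minus_mem[OF P primes_above_maximal_pow[OF I mx] uc] by blast
      have ec: "\<one> \<ominus> u \<otimes> b \<in> carrier R" using uc b(1) by simp
      have "u [^] k \<in> S" using u(1) by (induction k) auto
      \<comment> \<open>While \<open>u\<close> and \<open>b\<close> depend on \<open>J\<close>, the
        factor \<open>t\<close> depends only on I^N. It carries 1 - ub into I^N and so into
        \<open>J\<close>, and the remaining part of tx is a multiple of ux.\<close>
      then have "t \<otimes> (\<one> \<ominus> u \<otimes> b) \<in> J" using tM[OF ec _ b(2)] N[OF J] by blast
      then have tx: "(t \<otimes> (\<one> \<ominus> u \<otimes> b)) \<otimes> x \<in> J" by (rule J.I_r_closed[OF _ xc])
      have "(t \<otimes> b) \<otimes> (u \<otimes> x) \<in> J" by (rule J.I_l_closed[OF u(2)]) (simp add: tc b(1))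
      moreover have "t \<otimes> x = (t \<otimes> (\<one> \<ominus> u \<otimes> b)) \<otimes> x \<oplus> (t \<otimes> b) \<otimes> (u \<otimes> x)"
        using tc xc uc b(1) by algebra
      ultimately show ?thesis using J.a_closed[OF tx] by simp
    qed
    then have "t \<otimes> x \<in> core R I" unfolding core_def by blast
    then show "z \<in> loc_ideal R S (core R I)"
      unfolding x(1) using loc_frac_mem_loc_ideal_iff[OF core_id(1) xc x(3)] t by blast
  qed
qed

end

theorem proposition2p1:
  fixes R :: "('a, 'b) ring_scheme" and S I :: "'a set"
  assumes "cring R" and "noetherian_ring R"
    and "submonoid S R"
    and "ideal I R" and "zero_dimensional R I"
  shows "core (localization R S) (loc_ideal R S I) = loc_ideal R S (core R I)"
proof -
  interpret noetherian_ring_with_mult_set R S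
    using assms by (simp add: noetherian_ring_with_mult_set_def ring_with_mult_set_def)
  show ?thesis
    by (rule core_localization[OF assms(4) zero_dimensional_primes_above_maximal[OF assms(5)]])
qed

end
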